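(* Let $a,b\ge 0$ be integers and put $K=a+b+1$. Then $$H(a,b)=2\sum_{r=1}^{K}(-1)^r\left\{\binom{2r}{2a+2}\zeta(2r+1)+\binom{2r}{2b+1}\zeta(\overline{2r+1})\right\}H(K-r),$$ $$H^{\star}(a,b)=-2\sum_{r=1}^{K}\left\{\left[\binom{2r}{2a}-\delta_{r,a}\right]\zeta(2r+1)+\binom{2r}{2b+1}\zeta(\overline{2r+1})\right\}H^{\star}(K-r).$$
   Context: For positive integers $k_1,\dots,k_n$ with $k_n\ge 2$, define $$\zeta(k_1,\dots,k_n)=\sum_{1\le m_1<\cdots<m_n}\frac{1}{m_1^{k_1}\cdots m_n^{k_n}},\qquad \zeta^{\star}(k_1,\dots,k_n)=\sum_{1\le m_1\le\cdots\le m_n}\frac{1}{m_1^{k_1}\cdots m_n^{k_n}}.$$ For a positive integer $k$, $\zeta(\overline{k})=\sum_{m=1}^\infty \frac{(-1)^m}{m^k}$. For integers $a,b\ge 0$, $$H(a,b)=\zeta(\underbrace{2,\dots,2}_{a},3,\underbrace{2,\dots,2}_{b}),\qquad H^{\star}(a,b)=\zeta^{\star}(\underbrace{2,\dots,2}_{a},3,\underbrace{2,\dots,2}_{b}),$$ and for $a\ge1$, $H(a)=\zeta(\underbrace{2,\dots,2}_{a})$, $H^{\star}(a)=\zeta^{\star}(\underbrace{2,\dots,2}_{a})$, with the convention $H(0)=H^{\star}(0)=1$. $\delta_{r,a}$ is the Kronecker delta, and $\binom{n}{m}=0$ if $m>n\ge 0$. *)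

theory Defs
  imports "HOL-Analysis.Analysis"
begin

text \<open>
  A multi-index is a list \<^term>\<open>ks\<close> of positive integers, and the values below are meaningful
  when its last entry is at least 2. The terms are nonnegative, so the iterated
  series is an unordered sum over the strictly (resp. weakly) increasing lists of positive
  integers of the same length.
\<close>

definition mzv :: "nat list \<Rightarrow> real" where
  "mzv ks = (\<Sum>\<^sub>\<infinity>ms\<in>{ms :: nat list. length ms = length ks \<and> sorted_wrt (<) ms \<and> (\<forall>m\<in>set ms. 1 \<le> m)}.
     1 / (\<Prod>i<length ks. real (ms ! i) ^ (ks ! i)))"

definition mzv_star :: "nat list \<Rightarrow> real" where
  "mzv_star ks = (\<Sum>\<^sub>\<infinity>ms\<in>{ms :: nat list. length ms = length ks \<and> sorted_wrt (\<le>) ms \<and> (\<forall>m\<in>set ms. 1 \<le> m)}.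
     1 / (\<Prod>i<length ks. real (ms ! i) ^ (ks ! i)))"

text \<open>The series starts at \<open>m = 1\<close>; it is an ordered sum, since it converges only
  conditionally for \<open>k = 1\<close>.\<close>

definition zeta_bar :: "nat \<Rightarrow> real" where
  "zeta_bar k = (\<Sum>m. (-1) ^ Suc m / real (Suc m) ^ k)"

definition H3 :: "nat \<Rightarrow> nat \<Rightarrow> real" where
  "H3 a b = mzv (replicate a 2 @ [3] @ replicate b 2)"

definition H3_star :: "nat \<Rightarrow> nat \<Rightarrow> real" where
  "H3_star a b = mzv_star (replicate a 2 @ [3] @ replicate b 2)"

definition H2 :: "nat \<Rightarrow> real" where
  "H2 a = (if a = 0 then 1 else mzv (replicate a 2))"

definition H2_star :: "nat \<Rightarrow> real" where
  "H2_star a = (if a = 0 then 1 else mzv_star (replicate a 2))"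

definition kronecker_delta :: "nat \<Rightarrow> nat \<Rightarrow> real" where
  "kronecker_delta i j = (if i = j then 1 else 0)"

end

theory Submission imports Defs begin

text \<open>
  Write \<open>S\<^sub>N(2\<^sup>a, 3, 2\<^sup>b)\<close> for the partial sum of \<open>H\<^sup>\<star>(a, b)\<close> over indices at most \<open>N\<close>. With
  \<open>w\<^sub>N(l) = N!\<^sup>2 / ((N - l)! (N + l)!)\<close> and \<open>h(l) = \<Sum>\<^sub>k\<^sub>\<le>\<^sub>l k\<^bsup>-(2a+1)\<^esup>\<close> one has exactly
  \<open>S\<^sub>N(2\<^sup>a, 3, 2\<^sup>b) = - 2 \<Sum>\<^sub>l\<^sub>\<le>\<^sub>N (-1)\<^sup>l w\<^sub>N(l) (h(l) + h(l - 1)) / l\<^bsup>2b+2\<^esup>\<close>: this is the double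
  partial fraction expansion of the generating function, but once written down it follows by
  induction on \<open>N\<close> and \<open>b\<close>. As \<open>N\<close> grows, the weights tend to 1 and \<open>H\<^sup>\<star>(a, b)\<close> becomes an
  alternating Euler sum of odd weight. Likewise \<open>H\<^sup>\<star>(n) = - 2 \<Sum>\<^sub>m (-1)\<^sup>m / m\<^bsup>2n\<^esup>\<close> for \<open>n > 0\<close>.

  The Euler sum is evaluated by computing the absolutely convergent double sum of
  \<open>(-1)\<^sup>n sgn(k) n\<^bsup>-q\<^esup> ((k - n)\<^bsup>-p\<^esup> - k\<^bsup>-p\<^esup>)\<close> over all nonzero integers \<open>n \<noteq> k\<close> in both orders.
  Summing over \<open>k\<close> first telescopes to the Euler sum; summing over \<open>n\<close> first, partial fractions
  leave only two-sided alternating sums, which vanish for odd exponents.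

  The formula for \<open>H\<close> is deduced from that for \<open>H\<^sup>\<star>\<close>: multiplying the generating function of the
  truncated \<open>S\<^sub>N\<close>, with its two variables exchanged, by \<open>\<Prod>\<^sub>j\<^sub>\<le>\<^sub>N (1 - x/j\<^sup>2) (1 - y/j\<^sup>2)\<close> gives the
  generating function of the truncations of \<open>H\<close>.
\<close>

section \<open>Sums along exhaustions\<close>

text \<open>A finite subset of \<open>S\<close> meets only finitely many stages, so one
  \<open>F N\<close> contains it. Hence unordered sums can be computed along any convenient
  exhaustion.\<close>

lemma filterlim_finite_subsets_at_top_exhaustion:
  assumes "incseq F" "\<And>N. finite (F N)" "(\<Union>N. F N) = S"
  shows "filterlim F (finite_subsets_at_top S) sequentially"
  unfolding filterlim_finite_subsets_at_top
proof (intro allI impI, elim conjE)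
  fix X assume X: "finite X" "X \<subseteq> S"
  from X have "\<exists>N. X \<subseteq> F N"
  proof (induction X rule: finite_induct)
    case (insert x X)
    then obtain N M where "X \<subseteq> F N" "x \<in> F M" using assms(3) by auto
    moreover have "F N \<subseteq> F (max N M)" "F M \<subseteq> F (max N M)"
      using assms(1) by (simp_all add: incseq_def)
    ultimately show ?case by (metis insert_subset subset_iff)
  qed auto
  then obtain N where N: "X \<subseteq> F N" ..
  have "X \<subseteq> F M" if "N \<le> M" for M
    using N incseqD[OF assms(1) that] by blast
  then show "\<forall>\<^sub>F N in sequentially. finite (F N) \<and> X \<subseteq> F N \<and> F N \<subseteq> S"
    using assms(2,3) by (intro eventually_sequentiallyI[of N]) auto
qed

lemma has_sum_exhaustion:
  assumes "(f has_sum s) S" "incseq F" "\<And>N. finite (F N)" "(\<Union>N. F N) = S"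
  shows "(\<lambda>N. sum f (F N)) \<longlonglongrightarrow> s"
  using filterlim_compose[OF _ filterlim_finite_subsets_at_top_exhaustion[OF assms(2-4)]] assms(1)
  unfolding has_sum_def by blast

text \<open>For nonnegative terms the limit along one exhaustion bounds every finite partial sum.
  This gives summability, and uniqueness of limits then identifies the value.\<close>

lemma has_sum_if_nonneg_exhaustion:
  fixes f :: "'a \<Rightarrow> real"
  assumes nonneg: "\<And>x. x \<in> S \<Longrightarrow> 0 \<le> f x"
    and F: "incseq F" "\<And>N. finite (F N)" "(\<Union>N. F N) = S"
    and lim: "(\<lambda>N. sum f (F N)) \<longlonglongrightarrow> L"
  shows "(f has_sum L) S"
proof -
  have mono: "incseq (\<lambda>N. sum f (F N))"
  proof (intro incseq_SucI sum_mono2)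
    show "F N \<subseteq> F (Suc N)" for N using F(1) by (rule incseq_SucD)
    show "0 \<le> f x" if "x \<in> F (Suc N) - F N" for x N
      using that F(3) by (intro nonneg) blast
  qed (rule F(2))
  have "f summable_on S"
  proof (rule nonneg_bounded_partial_sums_imp_summable_on)
    have "eventually (\<lambda>X. finite X \<and> X \<subseteq> S) (finite_subsets_at_top S)"
      by (rule eventually_finite_subsets_at_top_weakI) simp
    then show "\<forall>\<^sub>F X in finite_subsets_at_top S. sum f X \<le> L"
    proof eventually_elim
      case (elim X)
      from filterlim_finite_subsets_at_top_exhaustion[OF F] elim
      have "eventually (\<lambda>N. finite (F N) \<and> X \<subseteq> F N \<and> F N \<subseteq> S) sequentially"
        unfolding filterlim_finite_subsets_at_top by blast
      then obtain N where "X \<subseteq> F N"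
        using eventually_sequentially by auto
      moreover have "0 \<le> f x" if "x \<in> F N - X" for x
        using that F(3) by (intro nonneg) blast
      ultimately have "sum f X \<le> sum f (F N)"
        using F(2) by (intro sum_mono2) auto
      also have "\<dots> \<le> L"
        using incseq_le[OF mono lim] .
      finally show ?case .
    qed
  qed (use nonneg in auto)
  then obtain s where s: "(f has_sum s) S" by (auto simp: summable_on_def)
  from has_sum_exhaustion[OF s F] lim have "s = L" by (rule LIMSEQ_unique)
  with s show ?thesis by simp
qed

section \<open>Truncated multiple zeta values\<close>

text \<open>The order is a parameter so that star and non-star values share one treatment.\<close>

definition truncated_mzv :: "(nat \<Rightarrow> nat \<Rightarrow> bool) \<Rightarrow> nat list \<Rightarrow> nat \<Rightarrow> real" where
  "truncated_mzv R ks N = (\<Sum>ms\<in>{ms. length ms = length ks \<and> sorted_wrt R ms \<and> set ms \<subseteq> {1..N}}.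
     1 / (\<Prod>i<length ks. real (ms ! i) ^ (ks ! i)))"

lemma finite_truncated_mzv_index: "finite {ms. length ms = n \<and> sorted_wrt R ms \<and> set ms \<subseteq> {1..N :: nat}}"
  by (rule finite_subset[OF _ finite_lists_length_eq[of "{1..N}" n]]) auto

lemma has_sum_if_truncated_mzv_tendsto:
  assumes "(\<lambda>N. truncated_mzv R ks N) \<longlonglongrightarrow> L"
  shows "((\<lambda>ms. 1 / (\<Prod>i<length ks. real (ms ! i) ^ (ks ! i))) has_sum L)
    {ms. length ms = length ks \<and> sorted_wrt R ms \<and> (\<forall>m\<in>set ms. 1 \<le> m)}"
proof (rule has_sum_if_nonneg_exhaustion)
  let ?F = "\<lambda>N. {ms. length ms = length ks \<and> sorted_wrt R ms \<and> set ms \<subseteq> {1..N}}"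
  show "incseq ?F" by (intro incseq_SucI) force
  show "\<And>N. finite (?F N)" by (rule finite_truncated_mzv_index)
  show "(\<Union>N. ?F N) = {ms. length ms = length ks \<and> sorted_wrt R ms \<and> (\<forall>m\<in>set ms. 1 \<le> m)}"
  proof (intro equalityI subsetI)
    fix ms assume "ms \<in> {ms. length ms = length ks \<and> sorted_wrt R ms \<and> (\<forall>m\<in>set ms. 1 \<le> m)}"
    \<comment> \<open>The sum of the entries bounds each entry and so serves as truncation
      level.\<close>
    then have "ms \<in> ?F (sum_list ms)" using member_le_sum_list by force
    then show "ms \<in> (\<Union>N. ?F N)" by blast
  qed auto
  show "(\<lambda>N. \<Sum>ms\<in>?F N. 1 / (\<Prod>i<length ks. real (ms ! i) ^ (ks ! i))) \<longlonglongrightarrow> L"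
    using assms by (simp add: truncated_mzv_def)
qed (auto intro!: prod_nonneg)

lemma mzv_eqI: "(\<lambda>N. truncated_mzv (<) ks N) \<longlonglongrightarrow> L \<Longrightarrow> mzv ks = L"
  unfolding mzv_def by (rule infsumI) (rule has_sum_if_truncated_mzv_tendsto)

lemma mzv_star_eqI: "(\<lambda>N. truncated_mzv (\<le>) ks N) \<longlonglongrightarrow> L \<Longrightarrow> mzv_star ks = L"
  unfolding mzv_star_def by (rule infsumI) (rule has_sum_if_truncated_mzv_tendsto)

lemma truncated_mzv_Nil: "truncated_mzv R [] N = 1"
proof -
  have "{ms. length ms = length [] \<and> sorted_wrt R ms \<and> set ms \<subseteq> {1..N}} = {[]}" by auto
  then show ?thesis by (simp add: truncated_mzv_def)
qed

lemma truncated_mzv_snoc_0: "truncated_mzv R (ks @ [k]) 0 = 0"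
proof -
  have "{ms. length ms = length (ks @ [k]) \<and> sorted_wrt R ms \<and> set ms \<subseteq> {1..0}} = {}" by auto
  then show ?thesis by (simp only: truncated_mzv_def sum.empty)
qed

text \<open>Splits off the last, hence largest, index \<open>m\<close>. The remaining indices run up
  to \<open>g m\<close>, which is \<open>m - 1\<close> for the strict and \<open>m\<close> for the
  weak order.\<close>

lemma truncated_mzv_snoc:
  assumes R: "\<And>j m. 1 \<le> j \<Longrightarrow> 1 \<le> m \<Longrightarrow> R j m \<longleftrightarrow> j \<le> g m" and g: "\<And>m. g m \<le> m"
  shows "truncated_mzv R (ks @ [k]) N = (\<Sum>m=1..N. truncated_mzv R ks (g m) / real m ^ k)"
proof -
  let ?I = "\<lambda>n N. {ms. length ms = n \<and> sorted_wrt R ms \<and> set ms \<subseteq> {1..N}}"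
  let ?n = "length ks"
  let ?t = "\<lambda>ks ms. 1 / (\<Prod>i<length ks. real (ms ! i) ^ (ks ! i))"
  have *: "?t (ks @ [k]) (ms @ [m]) = ?t ks ms / real m ^ k" if "length ms = ?n" for ms m
    using that by (simp add: nth_append)
  have "(\<Sum>m=1..N. truncated_mzv R ks (g m) / real m ^ k) = (\<Sum>m=1..N. \<Sum>ms\<in>?I ?n (g m). ?t ks ms / real m ^ k)"
    by (simp add: truncated_mzv_def sum_divide_distrib)
  also have "\<dots> = (\<Sum>(m, ms)\<in>Sigma {1..N} (\<lambda>m. ?I ?n (g m)). ?t ks ms / real m ^ k)"
    by (intro sum.Sigma ballI finite_atLeastAtMost finite_truncated_mzv_index)
  also have "\<dots> = (\<Sum>ms\<in>?I (Suc ?n) N. ?t (ks @ [k]) ms)"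
  proof (rule sum.reindex_bij_witness[where i = "\<lambda>ms. (last ms, butlast ms)" and j = "\<lambda>(m, ms). ms @ [m]"])
    fix a assume "a \<in> Sigma {1..N} (\<lambda>m. ?I ?n (g m))"
    then obtain m ms where a: "a = (m, ms)" "m \<in> {1..N}" "ms \<in> ?I ?n (g m)" by auto
    show "(last (case a of (m, ms) \<Rightarrow> ms @ [m]), butlast (case a of (m, ms) \<Rightarrow> ms @ [m])) = a"
      by (simp add: a)
    show "(case a of (m, ms) \<Rightarrow> ms @ [m]) \<in> ?I (Suc ?n) N"
      using a g[of m] by (force simp: sorted_wrt_append R)
    show "?t (ks @ [k]) (case a of (m, ms) \<Rightarrow> ms @ [m]) = (case a of (m, ms) \<Rightarrow> ?t ks ms / real m ^ k)"
      using a * by simp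
  next
    fix ms assume ms: "ms \<in> ?I (Suc ?n) N"
    then obtain ms' m where ms': "ms = ms' @ [m]" by (cases ms rule: rev_cases) auto
    show "(case (last ms, butlast ms) of (m, ms) \<Rightarrow> ms @ [m]) = ms" by (simp add: ms')
    show "(last ms, butlast ms) \<in> Sigma {1..N} (\<lambda>m. ?I ?n (g m))"
      using ms R by (fastforce simp: ms' sorted_wrt_append)
  qed
  finally show ?thesis by (simp add: truncated_mzv_def)
qed

lemma truncated_mzv_less_snoc_Suc:
  "truncated_mzv (<) (ks @ [k]) (Suc N) = truncated_mzv (<) (ks @ [k]) N + truncated_mzv (<) ks N / real (Suc N) ^ k"
  by (subst (1 2) truncated_mzv_snoc[where g = "\<lambda>m. m - 1"]) auto

lemma truncated_mzv_le_snoc_Suc: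
  "truncated_mzv (\<le>) (ks @ [k]) (Suc N) = truncated_mzv (\<le>) (ks @ [k]) N + truncated_mzv (\<le>) ks (Suc N) / real (Suc N) ^ k"
  by (subst (1 2) truncated_mzv_snoc[where g = "\<lambda>m. m"]) auto

lemma truncated_mzv_less_single: "truncated_mzv (<) [k] N = (\<Sum>m=1..N. 1 / real m ^ k)"
proof (induction N)
  case 0
  show ?case using truncated_mzv_snoc_0[of _ "[]"] by simp
next
  case (Suc N)
  then show ?case using truncated_mzv_less_snoc_Suc[of "[]" k N] by (simp add: truncated_mzv_Nil)
qed

section \<open>A finite identity for truncated star values\<close>

text \<open>This is \<open>(2 * N) choose (N - l)\<close> divided by
  \<open>(2 * N) choose N\<close>. Up to sign and a factor 2, these are the partial fraction
  coefficients of the product of \<open>1 / (1 - x / j^2)\<close> over \<open>j \<le> N\<close>. The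
  case distinction guards against truncated subtraction in \<open>N - l\<close>.\<close>

definition central_weight :: "nat \<Rightarrow> nat \<Rightarrow> real" where
  "central_weight N l = (if l \<le> N then fact N ^ 2 / (fact (N - l) * fact (N + l)) else 0)"

lemma central_weight_0 [simp]: "central_weight N 0 = 1"
  by (simp add: central_weight_def power2_eq_square)

lemma central_weight_eq_0 [simp]: "N < l \<Longrightarrow> central_weight N l = 0"
  by (simp add: central_weight_def)

text \<open>In this form without division the recursion also covers \<open>l \<ge> N\<close>, where
  both sides vanish.\<close>

lemma central_weight_Suc:
  "central_weight N (Suc l) * (real N + real l + 1) = central_weight N l * (real N - real l)"
proof (cases "Suc l \<le> N")
  case True
  then obtain d where N: "N = Suc (l + d)" by (metis add_Suc le_iff_add)
  have "N - l = Suc d" "N - Suc l = d" "N + Suc l = Suc (N + l)" by (simp_all add: N)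
  moreover have "real N - real l = real (Suc d)" by (simp add: N)
  ultimately show ?thesis using True
    by (simp add: central_weight_def field_simps del: of_nat_Suc) (simp add: algebra_simps)
next
  case False
  then show ?thesis by (cases "l = N") (auto simp: central_weight_def)
qed

text \<open>Passing from \<open>Suc N\<close> to \<open>N\<close> multiplies the weight by
  \<open>1 - l^2 / (N + 1)^2\<close>, since
  \<open>(N + 1)^2 - l^2 = (N + 1 - l) * (N + 1 + l)\<close>. This drives the recursion of the
  weighted sums in \<open>N\<close>.\<close>

lemma central_weight_step:
  assumes "l \<le> Suc N"
  shows "central_weight (Suc N) l - central_weight N l =
    central_weight (Suc N) l * real l ^ 2 / real (Suc N) ^ 2"
proof (cases "l = Suc N")
  case False
  then obtain d where N: "N = l + d" using assms by (metis le_Suc_eq le_iff_add)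
  have *: "Suc N - l = Suc d" "N - l = d" "Suc N + l = Suc (N + l)" by (simp_all add: N)
  have "fact N ^ 2 / (fact d * fact (N + l)) =
    central_weight (Suc N) l * (1 - real l ^ 2 / real (Suc N) ^ 2)" (is "_ = ?w * ?r")
  proof -
    have "?r = real (Suc d) * real (Suc (N + l)) / real (Suc N) ^ 2"
    proof -
      have "real (Suc N) ^ 2 - real l ^ 2 = real (Suc d) * real (Suc (N + l))"
        by (simp add: N algebra_simps power2_eq_square)
      then show ?thesis
        by (simp add: diff_divide_eq_iff del: of_nat_Suc)
    qed
    moreover have "?w = real (Suc N) ^ 2 * fact N ^ 2 / (real (Suc d) * fact d * (real (Suc (N + l)) * fact (N + l)))"
      using assms by (simp add: central_weight_def * power_mult_distrib del: of_nat_Suc)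
    ultimately show ?thesis by (simp del: of_nat_Suc)
  qed
  then show ?thesis using assms False
    by (simp add: central_weight_def[of N] * algebra_simps)
qed (simp add: field_simps)

lemma central_weight_nonneg: "0 \<le> central_weight N l"
  by (simp add: central_weight_def)

lemma central_weight_le_1: "central_weight N l \<le> 1"
proof (induction l)
  case (Suc l)
  show ?case
  proof (cases "l < N")
    case True
    have "central_weight N (Suc l) * (real N + real l + 1) \<le> 1 * (real N + real l + 1)"
      unfolding central_weight_Suc using Suc True by (intro mult_mono) auto
    then show ?thesis by (simp add: mult_le_cancel_right)
  qed simp
qed simp

lemma central_weight_tendsto: "(\<lambda>N. central_weight N l) \<longlonglongrightarrow> 1"
proof (induction l)
  case (Suc l)
  have "(\<lambda>N. (real N - real l) / (real N + real l + 1)) \<longlonglongrightarrow> 1"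
  proof -
    have "filterlim (\<lambda>N. real l + 1 + real N) at_top sequentially"
      by (intro filterlim_tendsto_add_at_top[OF tendsto_const] filterlim_real_sequentially)
    then have "(\<lambda>N. 1 - (2 * real l + 1) / (real l + 1 + real N)) \<longlonglongrightarrow> 1 - 0"
      by (intro tendsto_diff tendsto_const real_tendsto_divide_at_top[OF tendsto_const])
    moreover have "1 - (2 * real l + 1) / (real l + 1 + real N) = (real N - real l) / (real N + real l + 1)" for N
      by (simp add: field_simps)
    ultimately show ?thesis by simp
  qed
  from tendsto_mult[OF Suc this]
  have "(\<lambda>N. central_weight N l * ((real N - real l) / (real N + real l + 1))) \<longlonglongrightarrow> 1" by simp
  moreover have "central_weight N l * ((real N - real l) / (real N + real l + 1)) = central_weight N (Suc l)" for N
    using central_weight_Suc[of N l] by (simp add: field_simps add_pos_nonneg)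
  ultimately show ?case by simp
qed simp

definition weighted_alt_sum :: "(nat \<Rightarrow> real) \<Rightarrow> nat \<Rightarrow> nat \<Rightarrow> real" where
  "weighted_alt_sum c q N = (\<Sum>l=1..N. (-1) ^ l * central_weight N l * c l / real l ^ q)"

text \<open>This is the recursion in \<open>N\<close> obeyed by a truncated star value with last
  index 2: the factor \<open>l^2\<close> from \<open>central_weight_step\<close> lowers the exponent
  \<open>q + 2\<close> to \<open>q\<close>.\<close>

lemma weighted_alt_sum_Suc:
  "weighted_alt_sum c (q + 2) (Suc N) =
     weighted_alt_sum c (q + 2) N + weighted_alt_sum c q (Suc N) / real (Suc N) ^ 2"
proof -
  \<comment> \<open>The range may be extended to \<open>Suc N\<close> because
    \<open>central_weight N (Suc N) = 0\<close>.\<close>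
  have "weighted_alt_sum c (q + 2) N = (\<Sum>l=1..Suc N. (-1) ^ l * central_weight N l * c l / real l ^ (q + 2))"
    by (simp add: weighted_alt_sum_def)
  then have "weighted_alt_sum c (q + 2) N + weighted_alt_sum c q (Suc N) / real (Suc N) ^ 2 =
      (\<Sum>l=1..Suc N. (-1) ^ l * central_weight N l * c l / real l ^ (q + 2) +
         (-1) ^ l * central_weight (Suc N) l * c l / real l ^ q / real (Suc N) ^ 2)"
    by (simp only: weighted_alt_sum_def sum_divide_distrib sum.distrib)
  also have "\<dots> = weighted_alt_sum c (q + 2) (Suc N)"
    unfolding weighted_alt_sum_def
  proof (rule sum.cong[OF refl])
    fix l assume l: "l \<in> {1..Suc N}"
    have "l \<le> Suc N" and "l > 0" using l by auto
    from central_weight_step[OF this(1)]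
    have *: "central_weight (Suc N) l = central_weight N l + central_weight (Suc N) l * real l ^ 2 / real (Suc N) ^ 2"
      by (metis add.commute diff_add_cancel)
    have "(-1) ^ l * central_weight (Suc N) l * c l / real l ^ (q + 2) =
        (-1) ^ l * (central_weight N l + central_weight (Suc N) l * real l ^ 2 / real (Suc N) ^ 2) * c l / real l ^ (q + 2)"
      using * by (rule arg_cong[where f = "\<lambda>w. (-1) ^ l * w * c l / real l ^ (q + 2)"])
    also have "\<dots> = (-1) ^ l * central_weight N l * c l / real l ^ (q + 2) +
         (-1) ^ l * central_weight (Suc N) l * c l / real l ^ q / real (Suc N) ^ 2"
      using \<open>l > 0\<close> by (simp add: power_add power2_eq_square distrib_left distrib_right add_divide_distrib mult_ac del: of_nat_Suc)
    finally show "(-1) ^ l * central_weight N l * c l / real l ^ (q + 2) +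
         (-1) ^ l * central_weight (Suc N) l * c l / real l ^ q / real (Suc N) ^ 2 =
        (-1) ^ l * central_weight (Suc N) l * c l / real l ^ (q + 2)"
      by (rule sym)
  qed
  finally show ?thesis by simp
qed

text \<open>This symmetric combination of two consecutive partial sums is the one for which
  summation by parts against the weights leaves no inner sum.\<close>

definition two_sided_partial :: "(nat \<Rightarrow> real) \<Rightarrow> nat \<Rightarrow> real" where
  "two_sided_partial g l = (\<Sum>k=1..l. g k) + (\<Sum>k=1..<l. g k)"

text \<open>Closed form of \<open>\<Sum>\<^sub>l\<^sub>>\<^sub>k (-1)\<^sup>l w\<^sub>N(l)\<close>.\<close>

definition alt_weight_tail :: "nat \<Rightarrow> nat \<Rightarrow> real" where
  "alt_weight_tail N k = (-1) ^ k * central_weight N k * (real k - real N) / (2 * real N)"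

text \<open>Both follow once \<open>central_weight_Suc\<close> expresses the tail at
  \<open>k\<close> through the weight at \<open>Suc k\<close>. The difference telescopes; that the
  sum of consecutive tails is again a weight, times \<open>(k + 1) / N\<close>, is the special
  feature of these weights.\<close>

lemma alt_weight_tail_diff:
  assumes "N > 0"
  shows "alt_weight_tail N k - alt_weight_tail N (Suc k) = (-1) ^ Suc k * central_weight N (Suc k)"
    and "alt_weight_tail N k + alt_weight_tail N (Suc k) =
      (-1) ^ Suc k * central_weight N (Suc k) * real (Suc k) / real N"
proof -
  have *: "alt_weight_tail N k = (-1) ^ Suc k * (central_weight N (Suc k) * (real N + real k + 1)) / (2 * real N)"
    unfolding alt_weight_tail_def central_weight_Suc by (simp add: algebra_simps)
  show "alt_weight_tail N k - alt_weight_tail N (Suc k) = (-1) ^ Suc k * central_weight N (Suc k)"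
    "alt_weight_tail N k + alt_weight_tail N (Suc k) =
      (-1) ^ Suc k * central_weight N (Suc k) * real (Suc k) / real N"
    using assms unfolding * by (simp_all add: alt_weight_tail_def field_simps)
qed

text \<open>The tails telescope from \<open>- 1 / 2\<close> at 0 to 0 at \<open>N\<close>. The value
  makes the star formula below hold for the empty index as well, as long as
  \<open>N > 0\<close>.\<close>

lemma alt_weight_sum:
  assumes "N > 0"
  shows "weighted_alt_sum (\<lambda>_. 1) 0 N = - 1 / 2"
proof -
  have "(\<Sum>l=1..M. (-1) ^ l * central_weight N l) = alt_weight_tail N 0 - alt_weight_tail N M" for M
  proof (induction M)
    case (Suc M)
    then show ?case using alt_weight_tail_diff(1)[OF assms, of M] by simp
  qed simp
  from this[of N] assms show ?thesis by (simp add: weighted_alt_sum_def alt_weight_tail_def)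
qed

text \<open>Summation by parts: consecutive tails add up to a weight times \<open>l / N\<close>, and
  the boundary term carried through the induction vanishes at \<open>M = N\<close>.\<close>

lemma weighted_alt_sum_two_sided:
  assumes "N > 0"
  shows "weighted_alt_sum (two_sided_partial g) 0 N = (\<Sum>l=1..N. (-1) ^ l * central_weight N l * real l * g l) / real N"
proof -
  let ?T = "alt_weight_tail N" and ?G = "\<lambda>M. \<Sum>k=1..M. g k"
  have ts: "two_sided_partial g (Suc M) = 2 * ?G M + g (Suc M)" for M
    by (simp add: two_sided_partial_def atLeastLessThanSuc_atLeastAtMost)
  have "(\<Sum>l=1..M. (-1) ^ l * central_weight N l * two_sided_partial g l) =
     (\<Sum>l=1..M. (-1) ^ l * central_weight N l * real l * g l / real N) - 2 * ?T M * ?G M" for M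
  proof (induction M)
    case (Suc M)
    have "(\<Sum>l=1..Suc M. (-1) ^ l * central_weight N l * two_sided_partial g l) =
      (\<Sum>l=1..M. (-1) ^ l * central_weight N l * real l * g l / real N) - 2 * ?T M * ?G M
        + (?T M - ?T (Suc M)) * (2 * ?G M + g (Suc M))"
      using Suc unfolding alt_weight_tail_diff(1)[OF assms] by (simp add: ts)
    also have "\<dots> = (\<Sum>l=1..M. (-1) ^ l * central_weight N l * real l * g l / real N)
        + (?T M + ?T (Suc M)) * g (Suc M) - 2 * ?T (Suc M) * ?G (Suc M)"
      by (simp add: algebra_simps)
    finally show ?case unfolding alt_weight_tail_diff(2)[OF assms] by simp
  qed simp
  from this[of N] show ?thesis
    by (simp add: weighted_alt_sum_def alt_weight_tail_def sum_divide_distrib)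
qed

lemma truncated_mzv_le_replicate_2_eq:
  "n > 0 \<Longrightarrow> truncated_mzv (\<le>) (replicate n 2) N = - 2 * weighted_alt_sum (\<lambda>_. 1) (2 * n) N"
proof (induction n arbitrary: N)
  case (Suc n)
  have rep: "replicate (Suc n) 2 = replicate n 2 @ [2 :: nat]"
    by (simp flip: replicate_append_same)
  \<comment> \<open>For \<open>n = 0\<close> this reads \<open>1 = - 2 * (- 1 / 2)\<close>. It fails
    at truncation level 0, but the recursion only uses positive levels.\<close>
  have IH: "truncated_mzv (\<le>) (replicate n 2) (Suc N) = - 2 * weighted_alt_sum (\<lambda>_. 1) (2 * n) (Suc N)" for N
    using Suc.IH[of "Suc N"] by (cases "n = 0") (simp_all add: truncated_mzv_Nil alt_weight_sum)
  show ?case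
  proof (induction N)
    case 0
    show ?case unfolding rep truncated_mzv_snoc_0 by (simp add: weighted_alt_sum_def)
  next
    case (Suc N)
    have "truncated_mzv (\<le>) (replicate n 2 @ [2]) (Suc N) =
       - 2 * (weighted_alt_sum (\<lambda>_. 1) (2 * n + 2) N + weighted_alt_sum (\<lambda>_. 1) (2 * n) (Suc N) / real (Suc N) ^ 2)"
      using Suc unfolding rep truncated_mzv_le_snoc_Suc IH by (simp add: field_simps)
    then show ?case unfolding rep weighted_alt_sum_Suc[symmetric] by simp
  qed
qed simp

definition harmonic_two_sided :: "nat \<Rightarrow> nat \<Rightarrow> real" where
  "harmonic_two_sided p = two_sided_partial (\<lambda>k. 1 / real k ^ p)"

lemma truncated_mzv_le_2_3_2_eq:
  "truncated_mzv (\<le>) (replicate a 2 @ [3] @ replicate b 2) N =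
     - 2 * weighted_alt_sum (harmonic_two_sided (2 * a + 1)) (2 * b + 2) N"
proof (induction b arbitrary: N)
  case 0
  let ?c = "harmonic_two_sided (2 * a + 1)"
  show ?case
  proof (induction N)
    case 0
    show ?case using truncated_mzv_snoc_0[of _ "replicate a 2" 3] by (simp add: weighted_alt_sum_def)
  next
    case (Suc N)
    \<comment> \<open>This creates the index 3: summation by parts supplies
      \<open>l / (N + 1)\<close>, which lowers the power \<open>2 * a + 1\<close> to
      \<open>2 * a\<close> and adds a third factor \<open>1 / (N + 1)\<close> to the two from the
      recursion.\<close>
    have "weighted_alt_sum ?c 0 (Suc N) = weighted_alt_sum (\<lambda>_. 1) (2 * a) (Suc N) / real (Suc N)"
      unfolding harmonic_two_sided_def weighted_alt_sum_two_sided[OF zero_less_Suc]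
      unfolding weighted_alt_sum_def
      by (intro arg_cong[where f = "\<lambda>x. x / real (Suc N)"] sum.cong refl) (simp add: field_simps)
    moreover have "truncated_mzv (\<le>) (replicate a 2) (Suc N) = - 2 * weighted_alt_sum (\<lambda>_. 1) (2 * a) (Suc N)"
      using truncated_mzv_le_replicate_2_eq[of a "Suc N"] by (cases "a = 0") (simp_all add: truncated_mzv_Nil alt_weight_sum)
    ultimately have "truncated_mzv (\<le>) (replicate a 2) (Suc N) / real (Suc N) ^ 3 =
        - 2 * (weighted_alt_sum ?c 0 (Suc N) / real (Suc N) ^ 2)"
      by (simp add: power2_eq_square power3_eq_cube)
    then have "truncated_mzv (\<le>) (replicate a 2 @ [3]) (Suc N) =
       - 2 * (weighted_alt_sum ?c (0 + 2) N + weighted_alt_sum ?c 0 (Suc N) / real (Suc N) ^ 2)"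
      using Suc unfolding truncated_mzv_le_snoc_Suc by simp
    then show ?case unfolding weighted_alt_sum_Suc[symmetric] by simp
  qed
next
  case (Suc b)
  let ?c = "harmonic_two_sided (2 * a + 1)"
  have rep: "replicate a 2 @ [3] @ replicate (Suc b) 2 = (replicate a 2 @ [3] @ replicate b 2) @ [2 :: nat]"
    by (simp flip: replicate_append_same)
  note IH = Suc.IH
  show ?case
  proof (induction N)
    case 0
    show ?case unfolding rep truncated_mzv_snoc_0 by (simp add: weighted_alt_sum_def)
  next
    case (Suc N)
    have "truncated_mzv (\<le>) ((replicate a 2 @ [3] @ replicate b 2) @ [2]) (Suc N) =
       - 2 * (weighted_alt_sum ?c ((2 * b + 2) + 2) N + weighted_alt_sum ?c (2 * b + 2) (Suc N) / real (Suc N) ^ 2)"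
      using Suc unfolding rep truncated_mzv_le_snoc_Suc IH by (simp add: field_simps)
    then show ?case unfolding rep weighted_alt_sum_Suc[symmetric] by simp
  qed
qed

text \<open>Tannery's theorem: the weights lie between 0 and 1, tend to 1 and vanish beyond
  \<open>N\<close>, so the finite sum is a full series with a summable majorant.\<close>

lemma weighted_alt_sum_tendsto:
  assumes "summable (\<lambda>l. \<bar>c (Suc l)\<bar> / real (Suc l) ^ q)"
  shows "weighted_alt_sum c q \<longlonglongrightarrow> (\<Sum>l. (-1) ^ Suc l * c (Suc l) / real (Suc l) ^ q)"
proof -
  let ?f = "\<lambda>l N. (-1) ^ Suc l * central_weight N (Suc l) * c (Suc l) / real (Suc l) ^ q"
  have sum_eq: "weighted_alt_sum c q N = (\<Sum>l. ?f l N)" for N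
  proof -
    have "(\<Sum>l. ?f l N) = (\<Sum>l<N. ?f l N)" by (rule suminf_finite) auto
    also have "\<dots> = weighted_alt_sum c q N"
      by (simp add: weighted_alt_sum_def sum.atLeast1_atMost_eq)
    finally show ?thesis ..
  qed
  have "((\<lambda>N. \<Sum>l. ?f l N) \<longlongrightarrow> (\<Sum>l. (-1) ^ Suc l * 1 * c (Suc l) / real (Suc l) ^ q)) sequentially"
  proof (rule tannerys_theorem[where M = "\<lambda>l. \<bar>c (Suc l)\<bar> / real (Suc l) ^ q", THEN conjunct2, THEN conjunct2])
    show "(\<lambda>N. ?f l N) \<longlonglongrightarrow> (-1) ^ Suc l * 1 * c (Suc l) / real (Suc l) ^ q" for l
      by (intro tendsto_intros central_weight_tendsto) simp
    show "\<forall>\<^sub>F (k, n) in at_top \<times>\<^sub>F sequentially. norm (?f k n) \<le> \<bar>c (Suc k)\<bar> / real (Suc k) ^ q"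
      by (intro always_eventually allI) (auto simp: abs_mult central_weight_nonneg central_weight_le_1 power_abs
            intro!: divide_right_mono mult_left_le_one_le simp del: of_nat_Suc)
  qed (use assms in auto)
  then show ?thesis by (simp only: sum_eq[symmetric] mult_1_right)
qed

section \<open>Partial fractions\<close>

text \<open>With \<open>u = 1/x\<close>, \<open>v = 1/y\<close> and \<open>t = 1/(x + y)\<close>, this is the part of the partial fraction
  expansion of \<open>u\<^bsup>Q+1\<^esup> v\<^bsup>P+1\<^esup>\<close> that involves powers of \<open>u\<close>.\<close>

definition pf_part :: "real \<Rightarrow> real \<Rightarrow> nat \<Rightarrow> nat \<Rightarrow> real" where
  "pf_part u t P Q = (\<Sum>j\<le>P + Q. t ^ Suc j * real (j choose P) * u ^ (P + Q + 1 - j))"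

lemma pf_part_0_0: "pf_part u t 0 0 = t * u"
  by (simp add: pf_part_def)

lemma pf_part_0_Suc: "pf_part u t 0 (Suc Q) = t * u ^ (Q + 2) + t * pf_part u t 0 Q"
  unfolding pf_part_def add_Suc_right sum.atMost_Suc_shift by (simp add: sum_distrib_left mult_ac)

lemma pf_part_Suc_0: "pf_part u t (Suc P) 0 = t * pf_part u t P 0"
  unfolding pf_part_def add_Suc sum.atMost_Suc_shift
  by (auto simp: sum_distrib_left mult_ac binomial_eq_0 intro!: sum.cong)

lemma pf_part_Suc_Suc:
  "pf_part u t (Suc P) (Suc Q) = t * (pf_part u t P (Suc Q) + pf_part u t (Suc P) Q)"
proof -
  define n where "n = P + Suc Q"
  have n: "Suc P + Suc Q = Suc n" "Suc P + Q = n" by (simp_all add: n_def)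
  have "pf_part u t (Suc P) (Suc Q) = (\<Sum>j\<le>Suc n. t ^ Suc j * real (j choose Suc P) * u ^ (Suc n + 1 - j))"
    unfolding pf_part_def n ..
  also have "\<dots> = (\<Sum>j\<le>n. t * (t ^ Suc j * real (j choose P) * u ^ (n + 1 - j)
      + t ^ Suc j * real (j choose Suc P) * u ^ (n + 1 - j)))"
    unfolding sum.atMost_Suc_shift by (simp add: algebra_simps)
  also have "\<dots> = t * (pf_part u t P (Suc Q) + pf_part u t (Suc P) Q)"
    unfolding pf_part_def n n_def[symmetric] sum.distrib[symmetric] sum_distrib_left ..
  finally show ?thesis .
qed

text \<open>The hypothesis is \<open>1 / (x * y) = (1 / x + 1 / y) / (x + y)\<close> without
  denominators. Replacing one factor \<open>u * v\<close> by it lowers either exponent by one, which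
  matches Pascal's rule for the coefficients of \<open>pf_part\<close>.\<close>

lemma partial_fraction_two_powers:
  assumes "u * v = t * (u + v)"
  shows "u ^ Suc Q * v ^ Suc P = pf_part u t P Q + pf_part v t Q P"
proof (induction P arbitrary: Q)
  case 0
  show ?case
  proof (induction Q)
    case 0
    show ?case using assms by (simp add: pf_part_0_0 algebra_simps)
  next
    case (Suc Q)
    have "u ^ Suc (Suc Q) * v = u ^ Suc Q * (t * (u + v))" by (simp flip: assms)
    then show ?case using Suc by (simp add: pf_part_0_Suc pf_part_Suc_0 algebra_simps)
  qed
next
  case (Suc P)
  note IH = Suc.IH
  show ?case
  proof (induction Q)
    case 0
    have "u * v ^ Suc (Suc P) = v ^ Suc P * (t * (u + v))" by (simp flip: assms)
    then show ?case using IH[of 0] by (simp add: pf_part_0_Suc pf_part_Suc_0 algebra_simps)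
  next
    case (Suc Q)
    have "u ^ Suc (Suc Q) * v ^ Suc (Suc P) = u ^ Suc Q * v ^ Suc P * (t * (u + v))" by (simp flip: assms)
    also have "\<dots> = t * (u ^ Suc (Suc Q) * v ^ Suc P + u ^ Suc Q * v ^ Suc (Suc P))" by (simp add: algebra_simps)
    finally show ?case unfolding IH Suc pf_part_Suc_Suc by (simp add: algebra_simps)
  qed
qed

section \<open>Two-sided alternating sums\<close>

lemma sum_symmetric_int_interval:
  fixes f :: "int \<Rightarrow> real"
  shows "(\<Sum>n\<in>{- int N..int N} - {0}. f n) = (\<Sum>m=1..N. f (int m) + f (- int m))"
proof (induction N)
  case (Suc N)
  have "{- int (Suc N)..int (Suc N)} - {0} =
      insert (int (Suc N)) (insert (- int (Suc N)) ({- int N..int N} - {0}))" by auto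
  then show ?case using Suc by (simp add: algebra_simps)
qed simp

lemma symmetric_int_intervals:
  "incseq (\<lambda>N. {- int N..int N} - X)" "finite ({- int N..int N} - X)"
  "(\<Union>N. {- int N..int N} - X) = - X"
proof -
  have "n \<in> {- int (nat \<bar>n\<bar>)..int (nat \<bar>n\<bar>)}" for n by auto
  then show "(\<Union>N. {- int N..int N} - X) = - X" by blast
qed (auto simp: incseq_def)

lemmas has_sum_symmetric_partial_sums =
  has_sum_exhaustion[OF _ symmetric_int_intervals]

text \<open>Shifting the window by one exchanges two end terms, both tending to 0; induct on the
  shift in both directions. As \<open>1 / 0 = 0\<close>, the bound includes \<open>g 0 = 0\<close>.
  No absolute convergence is assumed, so exponent 1 is covered.\<close>

lemma shifted_window_sums_diff_tendsto_0:
  fixes g :: "int \<Rightarrow> real"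
  assumes bound: "\<And>m. \<bar>g m\<bar> \<le> 1 / \<bar>real_of_int m\<bar>"
  shows "(\<lambda>N. (\<Sum>m\<in>{j - int N..j + int N}. g m) - (\<Sum>m\<in>{- int N..int N}. g m)) \<longlonglongrightarrow> 0"
proof -
  have inv_lim: "(\<lambda>N. 1 / \<bar>real_of_int i + real N\<bar>) \<longlonglongrightarrow> 0" for i
  proof (rule tendsto_divide_0[OF tendsto_const])
    have "filterlim (\<lambda>N. real_of_int i + real N) at_top sequentially"
      by (intro filterlim_tendsto_add_at_top[OF tendsto_const] filterlim_real_sequentially)
    then have "filterlim (\<lambda>N. \<bar>real_of_int i + real N\<bar>) at_top sequentially"
      using filterlim_compose[OF filterlim_abs_real] by blast
    then show "filterlim (\<lambda>N. \<bar>real_of_int i + real N\<bar>) at_infinity sequentially"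
      by (rule filterlim_at_top_imp_at_infinity)
  qed
  have up: "(\<lambda>N. g (i + int N)) \<longlonglongrightarrow> 0" for i
    by (rule Lim_null_comparison[OF _ inv_lim[of i]]) (use bound[of "i + int _"] in auto)
  have down: "(\<lambda>N. g (i - int N)) \<longlonglongrightarrow> 0" for i
  proof (rule Lim_null_comparison[OF _ inv_lim[of "- i"]], intro always_eventually allI)
    fix N
    have "\<bar>real_of_int (i - int N)\<bar> = \<bar>real_of_int (- i) + real N\<bar>" by simp
    then show "norm (g (i - int N)) \<le> 1 / \<bar>real_of_int (- i) + real N\<bar>"
      using bound[of "i - int N"] by (simp only: real_norm_def)
  qed
  have shift: "(\<Sum>m\<in>{j + 1 - int N..j + 1 + int N}. g m) =
      (\<Sum>m\<in>{j - int N..j + int N}. g m) + (g (j + 1 + int N) - g (j - int N))" for j N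
  proof -
    have "insert (j - int N) {j + 1 - int N..j + 1 + int N} = insert (j + 1 + int N) {j - int N..j + int N}"
      by auto
    from arg_cong[OF this, of "sum g"] show ?thesis by simp
  qed
  have diff0: "(\<lambda>N. g (j + 1 + int N) - g (j - int N)) \<longlonglongrightarrow> 0" for j
    using tendsto_diff[OF up down] by simp
  show ?thesis
  proof (induction j rule: int_induct[where k = 0])
    case base
    show ?case by simp
  next
    case (step1 i)
    from tendsto_add[OF step1(2) diff0[of i]] show ?case unfolding shift by (simp add: algebra_simps)
  next
    case (step2 i)
    from tendsto_diff[OF step2(2) diff0[of "i - 1"]] show ?case using shift[of "i - 1"] by (simp add: algebra_simps)
  qed
qed

lemma shifted_window_sums_tendsto:
  fixes g :: "int \<Rightarrow> real"
  assumes "\<And>m. \<bar>g m\<bar> \<le> 1 / \<bar>real_of_int m\<bar>"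
    and lim: "(\<lambda>N. \<Sum>m\<in>{- int N..int N}. g m) \<longlonglongrightarrow> L"
  shows "(\<lambda>N. \<Sum>m\<in>{j - int N..j + int N}. g m) \<longlonglongrightarrow> L"
  using tendsto_add[OF shifted_window_sums_diff_tendsto_0[of g j, OF assms(1)] lim] by simp

definition alt_sign :: "int \<Rightarrow> real" where
  "alt_sign n = (if even n then 1 else -1)"

text \<open>For positive exponents the value at 0 is 0, so sums may run over whole integer windows
  without excluding poles.\<close>

definition recip_power :: "nat \<Rightarrow> int \<Rightarrow> real" where
  "recip_power i n = (1 / real_of_int n) ^ i"

lemma abs_alt_sign [simp]: "\<bar>alt_sign n\<bar> = 1"
  by (simp add: alt_sign_def)

lemma alt_sign_mult_self [simp]: "alt_sign n * alt_sign n = 1"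
  by (simp add: alt_sign_def)

lemma alt_sign_diff: "alt_sign (k - n) = alt_sign k * alt_sign n"
  by (simp add: alt_sign_def)

lemma alt_sign_int: "alt_sign (int m) = (-1) ^ m"
  by (simp add: alt_sign_def minus_one_power_iff)

lemma alt_sign_minus [simp]: "alt_sign (- n) = alt_sign n"
  by (simp add: alt_sign_def)

lemma recip_power_0 [simp]: "i > 0 \<Longrightarrow> recip_power i 0 = 0"
  by (simp add: recip_power_def)

lemma recip_power_minus: "recip_power i (- n) = (-1) ^ i * recip_power i n"
  by (simp add: recip_power_def power_minus[of "1 / real_of_int n"])

lemma recip_power_int: "recip_power i (int m) = 1 / real m ^ i"
  by (simp add: recip_power_def power_divide)

lemma abs_recip_int_le_1: "\<bar>1 / real_of_int n\<bar> \<le> 1"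
proof (cases "n = 0")
  case False
  then have "1 \<le> \<bar>real_of_int n\<bar>" by linarith
  then show ?thesis by (simp add: divide_le_eq_1)
qed simp

lemma abs_recip_power_le:
  assumes "i > 0"
  shows "\<bar>recip_power i n\<bar> \<le> 1 / \<bar>real_of_int n\<bar>"
proof -
  have "\<bar>recip_power i n\<bar> = \<bar>1 / real_of_int n\<bar> ^ i" by (simp add: recip_power_def power_abs)
  also have "\<dots> \<le> \<bar>1 / real_of_int n\<bar> ^ 1"
    using assms by (intro power_decreasing abs_recip_int_le_1) auto
  finally show ?thesis by simp
qed

text \<open>Leibniz' criterion is used because the conditionally convergent exponent 1 occurs
  later.\<close>

lemma zeta_bar_partial_sums:
  assumes "i > 0"
  shows "(\<lambda>N. \<Sum>m=1..N. (-1) ^ m / real m ^ i) \<longlonglongrightarrow> zeta_bar i"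
proof -
  have "summable (\<lambda>m. (-1) ^ m * (1 / real (Suc m) ^ i))"
  proof (rule summable_Leibniz(1))
    show "(\<lambda>m. 1 / real (Suc m) ^ i) \<longlonglongrightarrow> 0"
    proof (rule Lim_null_comparison[OF _ LIMSEQ_inverse_real_of_nat], intro always_eventually allI)
      fix n
      have "real (Suc n) ^ 1 \<le> real (Suc n) ^ i"
        using assms by (intro power_increasing) auto
      then show "norm (1 / real (Suc n) ^ i) \<le> inverse (real (Suc n))"
        by (simp add: field_simps del: of_nat_Suc)
    qed
    show "monoseq (\<lambda>m. 1 / real (Suc m) ^ i)"
      by (intro decseq_imp_monoseq decseq_SucI divide_left_mono power_mono) auto
  qed
  from summable_minus[OF this] have "summable (\<lambda>m. (-1) ^ Suc m / real (Suc m) ^ i)" by simp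
  then have "(\<lambda>m. (-1) ^ Suc m / real (Suc m) ^ i) sums zeta_bar i"
    unfolding zeta_bar_def by (rule summable_sums)
  then show ?thesis unfolding sums_def by (simp add: sum.atLeast1_atMost_eq)
qed

text \<open>The terms at \<open>m\<close> and \<open>- m\<close> cancel for odd exponents and agree
  for even ones; the centre of the window does not affect the limit.\<close>

lemma alt_recip_power_window_sums_tendsto:
  assumes "i > 0"
  shows "(\<lambda>N. \<Sum>m\<in>{j - int N..j + int N}. alt_sign m * recip_power i m) \<longlonglongrightarrow>
    (1 + (-1) ^ i) * zeta_bar i"
proof (rule shifted_window_sums_tendsto)
  fix m
  show "\<bar>alt_sign m * recip_power i m\<bar> \<le> 1 / \<bar>real_of_int m\<bar>"
    using abs_recip_power_le[OF assms] by (simp add: abs_mult)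
next
  have "(\<Sum>m\<in>{- int N..int N}. alt_sign m * recip_power i m) =
      (\<Sum>m=1..N. (1 + (-1) ^ i) * ((-1) ^ m / real m ^ i))" for N
  proof -
    have "(\<Sum>m\<in>{- int N..int N}. alt_sign m * recip_power i m) =
        (\<Sum>m\<in>{- int N..int N} - {0}. alt_sign m * recip_power i m)"
      using assms by (intro sum.mono_neutral_right) auto
    also have "\<dots> = (\<Sum>m=1..N. (1 + (-1) ^ i) * ((-1) ^ m / real m ^ i))"
      unfolding sum_symmetric_int_interval
      by (intro sum.cong refl) (simp add: alt_sign_int recip_power_minus recip_power_int algebra_simps add_divide_distrib)
    finally show ?thesis .
  qed
  then show "(\<lambda>N. \<Sum>m\<in>{- int N..int N}. alt_sign m * recip_power i m) \<longlonglongrightarrow> (1 + (-1) ^ i) * zeta_bar i"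
    using tendsto_mult[OF tendsto_const zeta_bar_partial_sums[OF assms]]
    by (simp add: sum_distrib_left)
qed

lemma alt_recip_power_reflected_sums_tendsto:
  assumes "i > 0"
  shows "(\<lambda>N. \<Sum>n\<in>{- int N..int N}. alt_sign n * recip_power i (k - n)) \<longlonglongrightarrow>
    alt_sign k * ((1 + (-1) ^ i) * zeta_bar i)"
proof -
  have "(\<Sum>n\<in>{- int N..int N}. alt_sign n * recip_power i (k - n)) =
     alt_sign k * (\<Sum>m\<in>{k - int N..k + int N}. alt_sign m * recip_power i m)" for N
    unfolding sum_distrib_left
    by (rule sum.reindex_bij_witness[where i = "\<lambda>m. k - m" and j = "\<lambda>n. k - n"])
       (auto simp: alt_sign_diff mult.assoc[symmetric])
  then show ?thesis
    using tendsto_mult[OF tendsto_const alt_recip_power_window_sums_tendsto[OF assms]] by simp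
qed

section \<open>The double sum\<close>

text \<open>The largest of three positive numbers is at least the geometric mean of the other two.\<close>

lemma inverse_mult3_le:
  fixes x y z :: real
  assumes "x > 0" "y > 0" "z > 0"
  shows "1 / (x * y * z) \<le> 1 / (x * sqrt x) * (1 / (y * sqrt y)) + 1 / (x * sqrt x) * (1 / (z * sqrt z))
    + 1 / (y * sqrt y) * (1 / (z * sqrt z))"
proof -
  have *: "1 / (x * y * z) \<le> 1 / (x * sqrt x) * (1 / (y * sqrt y))"
    if "x > 0" "y > 0" "x \<le> z" "y \<le> z" for x y z :: real
  proof -
    have "sqrt x * sqrt y \<le> sqrt z * sqrt z" using that by (intro mult_mono) auto
    then have "(x * y) * (sqrt x * sqrt y) \<le> (x * y) * z" using that by simp
    then have "1 / ((x * y) * z) \<le> 1 / ((x * y) * (sqrt x * sqrt y))"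
      using that by (intro divide_left_mono) auto
    then show ?thesis by (simp add: mult_ac)
  qed
  have nonneg: "0 \<le> 1 / (u * sqrt u) * (1 / (v * sqrt v))" if "u > 0" "v > 0" for u v :: real
    using that by simp
  have perm: "1 / (x * z * y) = 1 / (x * y * z)" "1 / (y * z * x) = 1 / (x * y * z)"
    by (simp_all add: mult_ac)
  note nonneg' = nonneg[OF assms(1,2)] nonneg[OF assms(1,3)] nonneg[OF assms(2,3)]
  consider "x \<le> z" "y \<le> z" | "x \<le> y" "z \<le> y" | "y \<le> x" "z \<le> x" by linarith
  then show ?thesis
  proof cases
    case 1
    from *[OF assms(1,2) this] nonneg' show ?thesis by linarith
  next
    case 2
    from *[OF assms(1,3) this] nonneg' show ?thesis unfolding perm by linarith
  next
    case 3
    from *[OF assms(2,3) this] nonneg' show ?thesis unfolding perm by linarith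
  qed
qed

text \<open>This is the power \<open>- 3 / 2\<close> of the absolute value, summable over the
  nonzero integers and shaped to match the bound of \<open>inverse_mult3_le\<close>.\<close>

definition decay :: "int \<Rightarrow> real" where
  "decay n = 1 / (\<bar>real_of_int n\<bar> * sqrt \<bar>real_of_int n\<bar>)"

lemma decay_nonneg [simp]: "0 \<le> decay n"
  by (simp add: decay_def)

lemma summable_decay_nat: "summable (\<lambda>m. 1 / (real (Suc m) * sqrt (real (Suc m))))"
proof -
  have "summable (\<lambda>m. real (Suc m) powr (- (3 / 2)))"
    by (subst summable_Suc_iff) (simp add: summable_real_powr_iff)
  moreover have "real (Suc m) powr (- (3 / 2)) = 1 / (real (Suc m) * sqrt (real (Suc m)))" for m
  proof -
    have "real (Suc m) powr (- (3 / 2)) = 1 / real (Suc m) powr (3 / 2)"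
      by (rule powr_minus_divide)
    also have "real (Suc m) powr (3 / 2) = real (Suc m) powr (1 + 1 / 2)"
      by simp
    also have "\<dots> = real (Suc m) powr 1 * real (Suc m) powr (1 / 2)"
      by (rule powr_add)
    also have "\<dots> = real (Suc m) * sqrt (real (Suc m))"
      by (simp add: powr_half_sqrt del: of_nat_Suc)
    finally show ?thesis .
  qed
  ultimately show ?thesis by (simp only:)
qed

lemma decay_summable_on: "decay summable_on - {0}"
proof -
  from summable_LIMSEQ[OF summable_decay_nat] obtain L
    where "(\<lambda>N. \<Sum>m<N. 1 / (real (Suc m) * sqrt (real (Suc m)))) \<longlonglongrightarrow> L" by blast
  then have "(\<lambda>N. \<Sum>m<N. 2 * (1 / (real (Suc m) * sqrt (real (Suc m))))) \<longlonglongrightarrow> 2 * L"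
    unfolding sum_distrib_left[symmetric] by (intro tendsto_intros)
  then have "(\<lambda>N. \<Sum>n\<in>{- int N..int N} - {0}. decay n) \<longlonglongrightarrow> 2 * L"
    unfolding sum_symmetric_int_interval by (simp add: sum.atLeast1_atMost_eq decay_def)
  from has_sum_if_nonneg_exhaustion[OF _ symmetric_int_intervals this]
  show ?thesis by (auto simp: summable_on_def)
qed

lemma decay_product_summable_on:
  "(\<lambda>(x, y). decay x * decay y) summable_on (- {0}) \<times> (- {0})"
proof -
  obtain S where S: "(decay has_sum S) (- {0})" using decay_summable_on by (auto simp: summable_on_def)
  show ?thesis
  proof (rule summable_on_SigmaI)
    show "((\<lambda>y. case (x, y) of (x, y) \<Rightarrow> decay x * decay y) has_sum decay x * S) (- {0})" for x
      using has_sum_cmult_right[OF S] by simp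
    show "(\<lambda>x. decay x * S) summable_on - {0}"
      using decay_summable_on by (rule summable_on_cmult_left)
  qed simp
qed

definition off_diagonal :: "(int \<times> int) set" where
  "off_diagonal = Sigma (- {0}) (\<lambda>n. - {0, n})"

text \<open>In each summand the two arguments can be taken as independent coordinates, which makes
  it part of the summable product family.\<close>

lemma decay_pair_summable_on:
  "(\<lambda>(n, k). decay n * decay k + decay n * decay (k - n) + decay k * decay (k - n)) summable_on off_diagonal"
proof -
  let ?Z = "(- {0 :: int}) \<times> (- {0 :: int})"
  have sub: "(\<lambda>(x, y). decay x * decay y) summable_on T" if "T \<subseteq> ?Z" for T
    using decay_product_summable_on that by (rule summable_on_subset_banach)
  have 1: "(\<lambda>(n, k). decay n * decay k) summable_on off_diagonal"
    by (rule sub) (auto simp: off_diagonal_def)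
  have "(\<lambda>(n, k). decay n * decay (k - n)) summable_on off_diagonal \<longleftrightarrow>
      (\<lambda>(x, y). decay x * decay y) summable_on {(x, y). x \<noteq> 0 \<and> y \<noteq> 0 \<and> x + y \<noteq> 0}"
    by (rule summable_on_reindex_bij_witness[where i = "\<lambda>(x, y). (x, x + y)" and j = "\<lambda>(n, k). (n, k - n)"])
       (auto simp: off_diagonal_def)
  moreover have "(\<lambda>(x, y). decay x * decay y) summable_on {(x, y). x \<noteq> 0 \<and> y \<noteq> 0 \<and> x + y \<noteq> 0}"
    by (rule sub) auto
  ultimately have 2: "(\<lambda>(n, k). decay n * decay (k - n)) summable_on off_diagonal" by blast
  have "(\<lambda>(n, k). decay k * decay (k - n)) summable_on off_diagonal \<longleftrightarrow>
      (\<lambda>(x, y). decay x * decay y) summable_on {(x, y). x \<noteq> 0 \<and> y \<noteq> 0 \<and> x \<noteq> y}"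
    by (rule summable_on_reindex_bij_witness[where i = "\<lambda>(x, y). (x - y, x)" and j = "\<lambda>(n, k). (k, k - n)"])
       (auto simp: off_diagonal_def)
  moreover have "(\<lambda>(x, y). decay x * decay y) summable_on {(x, y). x \<noteq> 0 \<and> y \<noteq> 0 \<and> x \<noteq> y}"
    by (rule sub) auto
  ultimately have 3: "(\<lambda>(n, k). decay k * decay (k - n)) summable_on off_diagonal" by blast
  from summable_on_add[OF summable_on_add[OF 1 2] 3] show ?thesis
    by (simp add: case_prod_unfold)
qed

text \<open>Subtracting the \<open>n\<close>-independent \<open>k\<^bsup>-p\<^esup>\<close> is what makes the double sum converge for \<open>p = 1\<close>.\<close>

definition euler_term :: "nat \<Rightarrow> nat \<Rightarrow> int \<Rightarrow> int \<Rightarrow> real" where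
  "euler_term p q n k =
     alt_sign n * sgn (real_of_int k) * recip_power q n * (recip_power p (k - n) - recip_power p k)"

text \<open>On the unit interval the \<open>p\<close>-th powers differ by at most \<open>p\<close>
  times the difference of the bases, here \<open>n / (k * (k - n))\<close>. Its numerator uses up
  one of the at least two factors \<open>1 / n\<close>, leaving \<open>1 / (n * k * (k - n))\<close>
  up to sign.\<close>

lemma abs_euler_term_le:
  assumes "q \<ge> 2" "n \<noteq> 0" "k \<noteq> 0" "k \<noteq> n"
  shows "\<bar>euler_term p q n k\<bar> \<le>
    real p * (decay n * decay k + decay n * decay (k - n) + decay k * decay (k - n))"
proof -
  have nz: "real_of_int n \<noteq> 0" "real_of_int k \<noteq> 0" "real_of_int (k - n) \<noteq> 0" using assms by auto
  have "\<bar>recip_power p (k - n) - recip_power p k\<bar> \<le> real p * \<bar>1 / real_of_int (k - n) - 1 / real_of_int k\<bar>"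
    unfolding recip_power_def real_norm_def[symmetric]
    by (rule norm_power_diff) (use abs_recip_int_le_1 in \<open>simp_all only: real_norm_def\<close>)
  also have "1 / real_of_int (k - n) - 1 / real_of_int k = real_of_int n / (real_of_int k * real_of_int (k - n))"
    using nz by (simp add: field_simps)
  finally have 1: "\<bar>recip_power p (k - n) - recip_power p k\<bar> \<le>
      real p * (\<bar>real_of_int n\<bar> / (\<bar>real_of_int k\<bar> * \<bar>real_of_int (k - n)\<bar>))"
    by (simp only: abs_divide abs_mult)
  have "\<bar>recip_power q n\<bar> = \<bar>1 / real_of_int n\<bar> ^ q" by (simp add: recip_power_def power_abs)
  also have "\<dots> \<le> \<bar>1 / real_of_int n\<bar> ^ 2"
    using assms by (intro power_decreasing abs_recip_int_le_1) auto
  finally have 2: "\<bar>recip_power q n\<bar> \<le> 1 / (\<bar>real_of_int n\<bar> * \<bar>real_of_int n\<bar>)"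
    by (simp add: power2_eq_square power_divide)
  have "\<bar>euler_term p q n k\<bar> = \<bar>recip_power q n\<bar> * \<bar>recip_power p (k - n) - recip_power p k\<bar>"
    using assms by (simp add: euler_term_def abs_mult abs_sgn_eq)
  also have "\<dots> \<le> 1 / (\<bar>real_of_int n\<bar> * \<bar>real_of_int n\<bar>) *
      (real p * (\<bar>real_of_int n\<bar> / (\<bar>real_of_int k\<bar> * \<bar>real_of_int (k - n)\<bar>)))"
    by (intro mult_mono 1 2) auto
  also have "\<dots> = real p * (1 / (\<bar>real_of_int n\<bar> * \<bar>real_of_int k\<bar> * \<bar>real_of_int (k - n)\<bar>))"
  proof -
    have "1 / (x * x) * (real p * (x / (y * z))) = real p * (1 / (x * y * z))" if "x \<noteq> 0" for x y z :: real
      using that by (simp add: mult_ac)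
    from this[of "\<bar>real_of_int n\<bar>"] nz(1) show ?thesis by (simp only: abs_eq_0 not_False_eq_True)
  qed
  also have "\<dots> \<le> real p * (decay n * decay k + decay n * decay (k - n) + decay k * decay (k - n))"
    unfolding decay_def using nz by (intro mult_left_mono inverse_mult3_le) auto
  finally show ?thesis .
qed

lemma euler_term_summable_on:
  assumes "q \<ge> 2"
  shows "(\<lambda>(n, k). euler_term p q n k) summable_on off_diagonal"
proof -
  let ?D = "\<lambda>n k. decay n * decay k + decay n * decay (k - n) + decay k * decay (k - n)"
  have "(\<lambda>x. real p * (case x of (n, k) \<Rightarrow> ?D n k)) summable_on off_diagonal"
    using decay_pair_summable_on by (rule summable_on_cmult_right)
  then have "(\<lambda>x. norm (case x of (n, k) \<Rightarrow> euler_term p q n k)) summable_on off_diagonal"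
    by (rule Infinite_Sum.abs_summable_on_comparison_test')
       (use abs_euler_term_le[OF assms] in \<open>auto simp: off_diagonal_def\<close>)
  then show ?thesis by (rule abs_summable_summable)
qed

text \<open>For odd \<open>p\<close> the sign turns \<open>k\<close> to the power \<open>- p\<close>
  into its absolute value. With \<open>m = k - n\<close> the other part is an absolute value too,
  except for a flipped sign when \<open>- n < m < 0\<close> and a zero at \<open>m = - n\<close>.
  The windows centred at 0 and \<open>- n\<close> cancel in the limit, so twice the flipped terms
  remain.\<close>

lemma sum_over_k_tendsto:
  assumes "odd p" "n > 0"
  shows "(\<lambda>N. \<Sum>k\<in>{- int N..int N} - {0, n}. sgn (real_of_int k) * (recip_power p (k - n) - recip_power p k))
    \<longlonglongrightarrow> - 2 * (\<Sum>j=1..<nat n. 1 / real j ^ p)"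
proof -
  have p: "p > 0" using assms(1) by (rule odd_pos)
  let ?g = "\<lambda>m :: int. \<bar>recip_power p m\<bar>"
  have sgn_rp: "sgn (real_of_int k) * recip_power p k = ?g k" for k
  proof -
    have "k = 0 \<or> sgn (real_of_int k) = sgn (recip_power p k)"
      using assms(1) p by (auto simp: recip_power_def sgn_if zero_less_power_eq)
    then show ?thesis using p by (auto simp: sgn_mult_self_eq linordered_idom_class.sgn_mult_self_eq abs_sgn mult.commute)
  qed
  \<comment> \<open>The set where \<open>m + n\<close> is positive but \<open>m\<close> is negative,
    so that the signs disagree.\<close>
  define C where "C = {- n + 1..- 1}"
  have shifted: "sgn (real_of_int (m + n)) * recip_power p m =
      ?g m - (if m = - n then ?g n else 0) - (if m \<in> C then 2 * ?g m else 0)" for m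
  proof -
    consider "m \<ge> 0 \<or> m < - n" | "m \<in> C" | "m = - n" unfolding C_def by force
    then show ?thesis
    proof cases
      case 1
      then consider "m = 0" | "m > 0" "m + n > 0" | "m < 0" "m + n < 0" using assms(2) by linarith
      then have "sgn (real_of_int (m + n)) * recip_power p m = ?g m"
        using p by cases (simp_all flip: sgn_rp del: of_int_add)
      moreover have "m \<noteq> - n" "m \<notin> C" using 1 assms(2) by (auto simp: C_def)
      ultimately show ?thesis by (simp del: of_int_add)
    next
      case 2
      then have *: "m < 0" "m + n > 0" by (auto simp: C_def)
      then have "sgn (real_of_int (m + n)) * recip_power p m = - ?g m"
        by (simp flip: sgn_rp del: of_int_add)
      moreover have "m \<noteq> - n" using * by auto
      ultimately show ?thesis using 2 by (simp del: of_int_add)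
    next
      case 3
      moreover have "- n \<notin> C" by (simp add: C_def)
      ultimately show ?thesis by (simp add: recip_power_minus abs_mult power_abs)
    qed
  qed
  let ?W = "\<lambda>j N. \<Sum>m\<in>{j - int N..j + int N}. ?g m"
  have h: "(\<Sum>m\<in>C. ?g m) = (\<Sum>j=1..<nat n. 1 / real j ^ p)"
    by (rule sum.reindex_bij_witness[where i = "\<lambda>j. - int j" and j = "\<lambda>m. nat (- m)"])
       (use assms in \<open>auto simp: C_def recip_power_def power_divide power_abs\<close>)
  \<comment> \<open>The term \<open>?g n\<close> lost at \<open>m = - n\<close>, that is at
    \<open>k = 0\<close>, cancels the one lost by excluding \<open>k = n\<close>.\<close>
  have eq: "(\<Sum>k\<in>{- int N..int N} - {0, n}. sgn (real_of_int k) * (recip_power p (k - n) - recip_power p k)) =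
      (?W (- n) N - (\<Sum>k\<in>{- int N..int N}. ?g k)) - 2 * (\<Sum>j=1..<nat n. 1 / real j ^ p)" if "N \<ge> nat n" for N
  proof -
    let ?I = "{- int N..int N}"
    have 1: "(\<Sum>k\<in>?I - {0, n}. sgn (real_of_int k) * (recip_power p (k - n) - recip_power p k)) =
        (\<Sum>k\<in>?I - {0, n}. sgn (real_of_int k) * recip_power p (k - n)) - (\<Sum>k\<in>?I - {0, n}. ?g k)"
      by (simp add: algebra_simps sgn_rp sum_subtractf)
    have "(\<Sum>k\<in>?I - {0, n}. sgn (real_of_int k) * recip_power p (k - n)) =
        (\<Sum>k\<in>?I. sgn (real_of_int k) * recip_power p (k - n))"
      using p by (intro sum.mono_neutral_left) auto
    also have "\<dots> = (\<Sum>m\<in>{- n - int N..- n + int N}. sgn (real_of_int (m + n)) * recip_power p m)"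
      by (rule sum.reindex_bij_witness[where i = "\<lambda>m. m + n" and j = "\<lambda>k. k - n"]) auto
    also have "\<dots> = ?W (- n) N - ?g n - 2 * (\<Sum>m\<in>C. ?g m)"
    proof -
      have sub: "{- n - int N..int N - n} \<inter> C = C" using that assms(2) by (auto simp: C_def)
      show ?thesis unfolding shifted sum_subtractf
        by (simp add: sum.inter_restrict[symmetric] sub sum_distrib_left[symmetric])
    qed
    finally have 2: "(\<Sum>k\<in>?I - {0, n}. sgn (real_of_int k) * recip_power p (k - n)) =
        ?W (- n) N - ?g n - 2 * (\<Sum>j=1..<nat n. 1 / real j ^ p)" unfolding h .
    have "(\<Sum>k\<in>?I - {0, n}. ?g k) = (\<Sum>k\<in>?I - {n}. ?g k)"
      using p by (intro sum.mono_neutral_left) auto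
    also have "\<dots> = (\<Sum>k\<in>?I. ?g k) - ?g n" using that assms(2) by (subst sum_diff1) auto
    finally have 3: "(\<Sum>k\<in>?I - {0, n}. ?g k) = (\<Sum>k\<in>?I. ?g k) - ?g n" .
    show ?thesis unfolding 1 2 3 by simp
  qed
  have "(\<lambda>N. ?W (- n) N - (\<Sum>k\<in>{- int N..int N}. ?g k)) \<longlonglongrightarrow> 0"
    by (rule shifted_window_sums_diff_tendsto_0) (simp add: abs_recip_power_le[OF p])
  from tendsto_diff[OF this tendsto_const]
  have "(\<lambda>N. (?W (- n) N - (\<Sum>k\<in>{- int N..int N}. ?g k)) - 2 * (\<Sum>j=1..<nat n. 1 / real j ^ p))
     \<longlonglongrightarrow> - 2 * (\<Sum>j=1..<nat n. 1 / real j ^ p)" by simp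
  then show ?thesis
    by (rule Lim_transform_eventually) (use eq in \<open>auto intro!: eventually_sequentiallyI[of "nat n"]\<close>)
qed

text \<open>Summability is already known, so symmetric partial sums determine the value. Negative
  \<open>n\<close> reduce to positive ones because the term is invariant under negating both
  \<open>n\<close> and \<open>k\<close> for odd \<open>p\<close> and even \<open>q\<close>.\<close>

lemma euler_term_has_sum_k:
  assumes "odd p" "even q" "q \<ge> 2" "n \<noteq> 0"
  shows "(euler_term p q n has_sum
      alt_sign n * recip_power q n * (- 2 * (\<Sum>j=1..<nat \<bar>n\<bar>. 1 / real j ^ p))) (- {0, n})"
proof -
  have pos: "(euler_term p q n has_sum
      alt_sign n * recip_power q n * (- 2 * (\<Sum>j=1..<nat n. 1 / real j ^ p))) (- {0, n})" if n: "n > 0" for n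
  proof -
    have "euler_term p q n summable_on (- {0, n})"
      using summable_on_SigmaD1[OF euler_term_summable_on[OF assms(3), unfolded off_diagonal_def], of n] n by simp
    then obtain s where s: "(euler_term p q n has_sum s) (- {0, n})" by (auto simp: summable_on_def)
    have "(\<lambda>N. alt_sign n * recip_power q n * (\<Sum>k\<in>{- int N..int N} - {0, n}.
          sgn (real_of_int k) * (recip_power p (k - n) - recip_power p k)))
        \<longlonglongrightarrow> alt_sign n * recip_power q n * (- 2 * (\<Sum>j=1..<nat n. 1 / real j ^ p))"
      by (intro tendsto_mult tendsto_const sum_over_k_tendsto assms n)
    moreover have "alt_sign n * recip_power q n * (\<Sum>k\<in>X. sgn (real_of_int k) * (recip_power p (k - n) - recip_power p k))
        = sum (euler_term p q n) X" for X
      by (simp add: euler_term_def sum_distrib_left mult_ac)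
    ultimately show ?thesis
      using s has_sum_symmetric_partial_sums[OF s] LIMSEQ_unique by (metis (no_types, lifting) ext)
  qed
  show ?thesis
  proof (cases "n > 0")
    case False
    have sym: "euler_term p q (- n) (- k) = euler_term p q n k" for k
    proof -
      have "recip_power p (- k - - n) = - recip_power p (k - n)"
        using recip_power_minus[of p "k - n"] assms(1) by simp
      then show ?thesis
        using assms(1,2) by (simp add: euler_term_def recip_power_minus sgn_minus algebra_simps)
    qed
    have "(euler_term p q n has_sum
      alt_sign (- n) * recip_power q (- n) * (- 2 * (\<Sum>j=1..<nat (- n). 1 / real j ^ p))) (- {0, n}) \<longleftrightarrow>
     (euler_term p q (- n) has_sum
      alt_sign (- n) * recip_power q (- n) * (- 2 * (\<Sum>j=1..<nat (- n). 1 / real j ^ p))) (- {0, - n})"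
      by (rule has_sum_reindex_bij_witness[where i = uminus and j = uminus]) (auto simp: sym)
    then show ?thesis using pos[of "- n"] False assms by (simp add: recip_power_minus)
  qed (use pos in simp)
qed

lemma sum_lessThan_double: "(\<Sum>j<2 * K. f j) = (\<Sum>r<K. f (2 * r) + f (Suc (2 * r)) :: real)"
  by (induction K) auto

text \<open>Take \<open>u = 1 / n\<close>, \<open>v = 1 / (k - n)\<close> and
  \<open>t = 1 / k\<close>. The subtracted power of \<open>k\<close> removes exactly one copy of the
  summand \<open>j = P\<close>; this is the origin of the Kronecker delta in the final
  formula.\<close>

lemma partial_fraction_recip_power:
  assumes "P + Q + 1 = 2 * K" "n \<noteq> 0" "k \<noteq> 0" "k \<noteq> n"
  shows "recip_power (Suc Q) n * (recip_power (Suc P) (k - n) - recip_power (Suc P) k) =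
    (\<Sum>j<2 * K. recip_power (Suc j) k *
      ((real (j choose P) - (if j = P then 1 else 0)) * recip_power (2 * K - j) n
        + real (j choose Q) * recip_power (2 * K - j) (k - n)))"
proof -
  define u v t where "u = 1 / real_of_int n" and "v = 1 / real_of_int (k - n)" and "t = 1 / real_of_int k"
  have rng: "{..<2 * K} = {..P + Q}" using assms(1) by auto
  have "real_of_int n \<noteq> 0" "real_of_int k \<noteq> 0" "real_of_int (k - n) \<noteq> 0" using assms by auto
  then have uvt: "u * v = t * (u + v)" unfolding u_def v_def t_def by (simp add: field_simps)
  have "(\<Sum>j<2 * K. t ^ Suc j * ((real (j choose P) - (if j = P then 1 else 0)) * u ^ (2 * K - j)
      + real (j choose Q) * v ^ (2 * K - j))) =
    (\<Sum>j<2 * K. t ^ Suc j * real (j choose P) * u ^ (P + Q + 1 - j)) +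
    (\<Sum>j<2 * K. t ^ Suc j * real (j choose Q) * v ^ (P + Q + 1 - j)) -
    (\<Sum>j<2 * K. if j = P then t ^ Suc j * u ^ (P + Q + 1 - j) else 0)"
    unfolding assms(1) sum.distrib[symmetric] sum_subtractf[symmetric]
    by (intro sum.cong refl) (simp add: algebra_simps)
  also have "\<dots> = pf_part u t P Q + pf_part v t Q P - t ^ Suc P * u ^ Suc Q"
    unfolding pf_part_def rng by (simp add: add.commute[of Q P])
  also have "\<dots> = u ^ Suc Q * (v ^ Suc P - t ^ Suc P)"
    unfolding partial_fraction_two_powers[OF uvt, symmetric] by (simp only: right_diff_distrib mult.commute)
  finally show ?thesis unfolding recip_power_def u_def v_def t_def by (rule sym)
qed

text \<open>After partial fractions only two-sided alternating sums over \<open>n\<close> remain.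
  They vanish for odd exponents, which leaves \<open>j = 2 * r\<close>; the last two terms correct
  for the excluded points 0 and \<open>k\<close>.\<close>

lemma euler_term_has_sum_n:
  assumes K: "P + Q + 1 = 2 * K" and "Q \<ge> 1" "k \<noteq> 0"
  shows "((\<lambda>n. euler_term (Suc P) (Suc Q) n k) has_sum
     sgn (real_of_int k) * ((\<Sum>r<K. recip_power (2 * r + 1) k * (2 * zeta_bar (2 * (K - r))) *
       ((real ((2 * r) choose P) - (if 2 * r = P then 1 else 0)) + real ((2 * r) choose Q) * alt_sign k))
       - real ((2 * K) choose Suc Q) * recip_power (2 * K + 1) k
       - alt_sign k * (real ((2 * K) choose Suc P) - 1) * recip_power (2 * K + 1) k)) (- {0, k})"
    (is "(_ has_sum sgn _ * ?V) _")
proof -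
  let ?\<delta> = "\<lambda>j. if j = P then 1 else 0 :: real"
  \<comment> \<open>The expansion is also evaluated at \<open>n = 0\<close> and
    \<open>n = k\<close>, where singular powers count as 0; the surplus values \<open>R 0\<close>
    and \<open>R k\<close> are subtracted afterwards.\<close>
  define R where "R n = (\<Sum>j<2 * K. recip_power (Suc j) k *
      ((real (j choose P) - ?\<delta> j) * recip_power (2 * K - j) n
        + real (j choose Q) * recip_power (2 * K - j) (k - n)))" for n
  let ?E = "\<lambda>i. (1 + (-1) ^ i) * zeta_bar i"
  have "recip_power (Suc j) k * recip_power (2 * K - j) k = recip_power (2 * K + 1) k" if "j < 2 * K" for j
    using that by (simp add: recip_power_def power_add[symmetric] del: power_Suc)
  then have prod: "recip_power (Suc j) k * (x * recip_power (2 * K - j) k) = x * recip_power (2 * K + 1) k"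
    if "j < 2 * K" for j x
    using that by (metis mult.left_commute)
  have "K > 0" using K by simp
  then have hockey: "(\<Sum>j<2 * K. real (j choose i)) = real ((2 * K) choose Suc i)" for i
    using sum_choose_upper[of i "2 * K - 1"] lessThan_Suc_atMost[of "2 * K - 1"]
    by (simp flip: of_nat_sum)
  have "R 0 = (\<Sum>j<2 * K. real (j choose Q)) * recip_power (2 * K + 1) k"
    unfolding R_def sum_distrib_right
    by (intro sum.cong refl) (simp add: prod del: mult_Suc)
  then have R0: "R 0 = real ((2 * K) choose Suc Q) * recip_power (2 * K + 1) k" unfolding hockey .
  have "R k = (\<Sum>j<2 * K. real (j choose P) - ?\<delta> j) * recip_power (2 * K + 1) k"
    unfolding R_def sum_distrib_right
    by (intro sum.cong refl) (simp add: prod del: mult_Suc)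
  then have Rk: "R k = (real ((2 * K) choose Suc P) - 1) * recip_power (2 * K + 1) k"
    using K unfolding sum_subtractf hockey by (simp add: sum.delta)
  have lim1: "(\<lambda>N. \<Sum>n\<in>{- int N..int N}. alt_sign n * R n) \<longlonglongrightarrow>
     (\<Sum>j<2 * K. recip_power (Suc j) k *
      ((real (j choose P) - ?\<delta> j) * ?E (2 * K - j) + real (j choose Q) * (alt_sign k * ?E (2 * K - j))))"
    (is "_ \<longlonglongrightarrow> ?L")
  proof -
    have "(\<Sum>n\<in>X. alt_sign n * R n) = (\<Sum>j<2 * K. recip_power (Suc j) k *
      ((real (j choose P) - ?\<delta> j) * (\<Sum>n\<in>X. alt_sign n * recip_power (2 * K - j) n)
       + real (j choose Q) * (\<Sum>n\<in>X. alt_sign n * recip_power (2 * K - j) (k - n))))" for X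
      unfolding R_def sum_distrib_left sum.distrib[symmetric]
      by (subst sum.swap) (intro sum.cong refl, simp add: algebra_simps)
    then show ?thesis
      using alt_recip_power_window_sums_tendsto[where j = 0]
      by (auto intro!: tendsto_intros alt_recip_power_reflected_sums_tendsto simp: alt_recip_power_window_sums_tendsto[where j = 0, simplified])
  qed
  have "?L = (\<Sum>r<K. recip_power (2 * r + 1) k * (2 * zeta_bar (2 * (K - r))) *
       ((real ((2 * r) choose P) - (if 2 * r = P then 1 else 0)) + real ((2 * r) choose Q) * alt_sign k))"
    unfolding sum_lessThan_double
  proof (intro sum.cong refl)
    fix r assume "r \<in> {..<K}"
    then have "2 * K - 2 * r = 2 * (K - r)" "odd (2 * K - Suc (2 * r))" by auto
    then show "recip_power (Suc (2 * r)) k * ((real (2 * r choose P) - ?\<delta> (2 * r)) * ?E (2 * K - 2 * r)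
        + real (2 * r choose Q) * (alt_sign k * ?E (2 * K - 2 * r))) +
      recip_power (Suc (Suc (2 * r))) k * ((real (Suc (2 * r) choose P) - ?\<delta> (Suc (2 * r))) * ?E (2 * K - Suc (2 * r))
        + real (Suc (2 * r) choose Q) * (alt_sign k * ?E (2 * K - Suc (2 * r)))) =
      recip_power (2 * r + 1) k * (2 * zeta_bar (2 * (K - r))) *
       ((real ((2 * r) choose P) - (if 2 * r = P then 1 else 0)) + real ((2 * r) choose Q) * alt_sign k)"
      by (simp add: algebra_simps)
  qed
  then have V: "?V = ?L - R 0 - alt_sign k * R k" unfolding R0 Rk by simp
  have eq: "(\<Sum>n\<in>{- int N..int N} - {0, k}. euler_term (Suc P) (Suc Q) n k) =
      sgn (real_of_int k) * ((\<Sum>n\<in>{- int N..int N}. alt_sign n * R n) - R 0 - alt_sign k * R k)"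
    if "N \<ge> nat \<bar>k\<bar>" for N
  proof -
    have "(\<Sum>n\<in>{- int N..int N} - {0, k}. euler_term (Suc P) (Suc Q) n k) =
      sgn (real_of_int k) * (\<Sum>n\<in>{- int N..int N} - {0, k}. alt_sign n * R n)"
      unfolding sum_distrib_left
    proof (intro sum.cong refl)
      fix n assume "n \<in> {- int N..int N} - {0, k}"
      then have "R n = recip_power (Suc Q) n * (recip_power (Suc P) (k - n) - recip_power (Suc P) k)"
        unfolding R_def using K assms(3) by (intro partial_fraction_recip_power[symmetric]) auto
      then show "euler_term (Suc P) (Suc Q) n k = sgn (real_of_int k) * (alt_sign n * R n)"
        by (simp only: euler_term_def mult_ac)
    qed
    moreover have "(\<Sum>n\<in>{- int N..int N} - {0, k}. alt_sign n * R n) =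
        (\<Sum>n\<in>{- int N..int N}. alt_sign n * R n) - (\<Sum>n\<in>{0, k}. alt_sign n * R n)"
      using that by (intro sum_diff) auto
    ultimately show ?thesis using assms(3) by (simp add: alt_sign_def)
  qed
  have "(\<lambda>N. sgn (real_of_int k) * ((\<Sum>n\<in>{- int N..int N}. alt_sign n * R n) - R 0 - alt_sign k * R k))
      \<longlonglongrightarrow> sgn (real_of_int k) * ?V"
    unfolding V by (intro tendsto_intros lim1)
  then have lim: "(\<lambda>N. \<Sum>n\<in>{- int N..int N} - {0, k}. euler_term (Suc P) (Suc Q) n k) \<longlonglongrightarrow> sgn (real_of_int k) * ?V"
    by (rule Lim_transform_eventually) (use eq in \<open>auto intro!: eventually_sequentiallyI[of "nat \<bar>k\<bar>"]\<close>)
  have "(\<lambda>(k, n). euler_term (Suc P) (Suc Q) n k) summable_on Sigma (- {0}) (\<lambda>k. - {0, k})"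
  proof -
    have "(\<lambda>(k, n). euler_term (Suc P) (Suc Q) n k) summable_on Sigma (- {0}) (\<lambda>k. - {0, k}) \<longleftrightarrow>
      (\<lambda>(n, k). euler_term (Suc P) (Suc Q) n k) summable_on off_diagonal"
      by (rule summable_on_reindex_bij_witness[where i = "\<lambda>(x, y). (y, x)" and j = "\<lambda>(x, y). (y, x)"])
         (auto simp: off_diagonal_def)
    then show ?thesis using euler_term_summable_on[of "Suc Q" "Suc P"] assms(2) by simp
  qed
  from summable_on_SigmaD1[OF this, of k] assms(3)
  obtain s where s: "((\<lambda>n. euler_term (Suc P) (Suc Q) n k) has_sum s) (- {0, k})"
    by (auto simp: summable_on_def)
  from LIMSEQ_unique[OF has_sum_symmetric_partial_sums[OF s] lim] s show ?thesis by simp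
qed

section \<open>Alternating Euler sums of odd weight\<close>

lemma mzv_single_partial_sums:
  assumes "i \<ge> 2"
  shows "(\<lambda>N. \<Sum>m=1..N. 1 / real m ^ i) \<longlonglongrightarrow> mzv [i]"
proof -
  have "summable (\<lambda>m. 1 / real (Suc m) ^ i)"
    by (subst summable_Suc_iff) (use inverse_power_summable[OF assms, where 'a = real] in \<open>simp add: inverse_eq_divide\<close>)
  then obtain L where "(\<lambda>N. \<Sum>m=1..N. 1 / real m ^ i) \<longlonglongrightarrow> L"
    unfolding summable_def sums_def by (auto simp: sum.atLeast1_atMost_eq)
  moreover from this have "mzv [i] = L" by (intro mzv_eqI) (simp add: truncated_mzv_less_single)
  ultimately show ?thesis by simp
qed

text \<open>Telescopes \<open>1 / (l + 1) \<le> 2 * (sqrt (l + 1) - sqrt l)\<close>. The crude bound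
  suffices: divided by \<open>l^2\<close> it decays with exponent \<open>3 / 2\<close>, a majorant
  already known to be summable.\<close>

lemma harmonic_le_sqrt: "(\<Sum>k=1..l. 1 / real k) \<le> 2 * sqrt (real l)"
proof (induction l)
  case (Suc l)
  define s t where "s = sqrt (real (Suc l))" and "t = sqrt (real l)"
  have st: "s * s = t * t + 1" "1 \<le> s" "0 \<le> t" "t \<le> s" by (simp_all add: s_def t_def)
  have "1 = (s - t) * (s + t)" using st(1) by (simp add: algebra_simps)
  also have "\<dots> \<le> (s - t) * (2 * s)" using st by (intro mult_left_mono) auto
  also have "\<dots> \<le> (s - t) * (2 * s) * s"
    using mult_left_mono[OF st(2), of "(s - t) * (2 * s)"] st by simp
  finally have "1 / (s * s) \<le> 2 * (s - t)"
    using st(2) by (subst pos_divide_le_eq) (simp_all add: mult_ac)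
  moreover have "s * s = real (Suc l)" by (simp add: s_def)
  ultimately have "1 / real (Suc l) \<le> 2 * (s - t)" by simp
  then show ?case using Suc by (simp add: s_def t_def)
qed simp

lemma harmonic_two_sided_bound:
  assumes "p > 0" "l > 0"
  shows "0 \<le> harmonic_two_sided p l" "harmonic_two_sided p l \<le> 4 * sqrt (real l)"
proof -
  show "0 \<le> harmonic_two_sided p l"
    unfolding harmonic_two_sided_def two_sided_partial_def by (intro add_nonneg_nonneg sum_nonneg) auto
  have le: "1 / real k ^ p \<le> 1 / real k" for k
  proof (cases "k = 0")
    case False
    then have "real k ^ 1 \<le> real k ^ p" using assms by (intro power_increasing) auto
    then show ?thesis using False by (simp add: field_simps)
  qed (use assms in \<open>simp add: zero_power\<close>)
  have "(\<Sum>k=1..<l. 1 / real k ^ p) \<le> (\<Sum>k=1..l. 1 / real k ^ p)" by (intro sum_mono2) auto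
  then have "harmonic_two_sided p l \<le> 2 * (\<Sum>k=1..l. 1 / real k ^ p)"
    by (simp add: harmonic_two_sided_def two_sided_partial_def)
  also have "\<dots> \<le> 2 * (\<Sum>k=1..l. 1 / real k)" by (intro mult_left_mono sum_mono le) auto
  also have "\<dots> \<le> 4 * sqrt (real l)" using harmonic_le_sqrt[of l] by simp
  finally show "harmonic_two_sided p l \<le> 4 * sqrt (real l)" .
qed

lemma harmonic_two_sided_summable:
  assumes "p > 0" "q \<ge> 2"
  shows "summable (\<lambda>l. \<bar>harmonic_two_sided p (Suc l)\<bar> / real (Suc l) ^ q)"
proof (rule summable_comparison_test'[OF summable_mult[OF summable_decay_nat, of 4]])
  fix l
  define x where "x = real (Suc l)"
  have x: "x \<ge> 1" by (simp add: x_def)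
  have "\<bar>harmonic_two_sided p (Suc l)\<bar> / x ^ q \<le> 4 * sqrt x / x ^ 2"
    using harmonic_two_sided_bound[OF assms(1), of "Suc l"] x assms(2)
    by (intro frac_le power_increasing) (auto simp: x_def simp del: of_nat_Suc)
  also have "\<dots> = 4 * (1 / (x * sqrt x))"
  proof -
    have "sqrt x * sqrt x = x" "sqrt x > 0" using x by simp_all
    then show ?thesis using x by (simp add: field_simps power2_eq_square)
  qed
  finally show "norm (\<bar>harmonic_two_sided p (Suc l)\<bar> / real (Suc l) ^ q) \<le>
      4 * (1 / (real (Suc l) * sqrt (real (Suc l))))"
    by (simp add: x_def del: of_nat_Suc)
qed

definition alt_euler_sum :: "nat \<Rightarrow> nat \<Rightarrow> real" where
  "alt_euler_sum p q = (\<Sum>l. (-1) ^ Suc l * harmonic_two_sided p (Suc l) / real (Suc l) ^ q)"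

lemma alt_euler_sum_partial_sums:
  assumes "p > 0" "q \<ge> 2"
  shows "(\<lambda>N. \<Sum>m=1..N. (-1) ^ m * harmonic_two_sided p m / real m ^ q) \<longlonglongrightarrow> alt_euler_sum p q"
proof -
  have "summable (\<lambda>l. (-1) ^ Suc l * harmonic_two_sided p (Suc l) / real (Suc l) ^ q)"
    by (rule summable_rabs_cancel)
       (use harmonic_two_sided_summable[OF assms] in \<open>simp add: abs_mult power_abs del: of_nat_Suc\<close>)
  then show ?thesis
    unfolding alt_euler_sum_def summable_sums_iff sums_def by (simp add: sum.atLeast1_atMost_eq)
qed

text \<open>\<open>S1\<close> and \<open>S2\<close> evaluate the same double sum of
  \<open>euler_term\<close>, summing first over \<open>k\<close> and first over \<open>n\<close>;
  equating them gives the formula.\<close>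

lemma alt_euler_sum_eq:
  fixes a b :: nat
  defines "K \<equiv> a + b + 1"
  shows "alt_euler_sum (2 * a + 1) (2 * b + 2) =
    real ((2 * K) choose (2 * b + 2)) * mzv [2 * K + 1] + real ((2 * K) choose (2 * a + 1)) * zeta_bar (2 * K + 1)
    - (\<Sum>r<K. 2 * zeta_bar (2 * (K - r)) *
       ((real ((2 * r) choose (2 * a)) - (if r = a then 1 else 0)) * mzv [2 * r + 1]
        + real ((2 * r) choose (2 * b + 1)) * zeta_bar (2 * r + 1)))"
proof -
  let ?p = "2 * a + 1" and ?q = "2 * b + 2" and ?w = "2 * K + 1"
  have PQ: "2 * a + (2 * b + 1) + 1 = 2 * K" by (simp add: K_def)
  obtain S where S: "((\<lambda>(n, k). euler_term ?p ?q n k) has_sum S) off_diagonal"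
    using euler_term_summable_on[of ?q ?p] by (auto simp: summable_on_def)
  from S have "((\<lambda>n. alt_sign n * recip_power ?q n * (- 2 * (\<Sum>j=1..<nat \<bar>n\<bar>. 1 / real j ^ ?p))) has_sum S) (- {0})"
    unfolding off_diagonal_def
  proof (rule has_sum_SigmaD)
    fix n :: int assume "n \<in> - {0}"
    then show "((\<lambda>k. case (n, k) of (n, k) \<Rightarrow> euler_term ?p ?q n k) has_sum
        alt_sign n * recip_power ?q n * (- 2 * (\<Sum>j=1..<nat \<bar>n\<bar>. 1 / real j ^ ?p))) (- {0, n})"
      using euler_term_has_sum_k[of ?p ?q n] by simp
  qed
  from has_sum_symmetric_partial_sums[OF this]
  have "(\<lambda>N. \<Sum>m=1..N. 2 * ((-1) ^ m / real m ^ ?q * (- 2 * (\<Sum>j=1..<m. 1 / real j ^ ?p)))) \<longlonglongrightarrow> S"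
    unfolding sum_symmetric_int_interval by (simp add: alt_sign_int recip_power_minus recip_power_int)
  moreover have "(\<Sum>m=1..N. 2 * ((-1) ^ m / real m ^ ?q * (- 2 * (\<Sum>j=1..<m. 1 / real j ^ ?p)))) =
     - 2 * ((\<Sum>m=1..N. (-1) ^ m * harmonic_two_sided ?p m / real m ^ ?q) - (\<Sum>m=1..N. (-1) ^ m / real m ^ ?w))" for N
  proof -
    have "2 * ((-1) ^ m / real m ^ ?q * (- 2 * (\<Sum>j=1..<m. 1 / real j ^ ?p))) =
       - 2 * ((-1) ^ m * harmonic_two_sided ?p m / real m ^ ?q - (-1) ^ m / real m ^ ?w)" if "m \<in> {1..N}" for m
    proof -
    from that obtain m' where m: "m = Suc m'" by (cases m) auto
    \<comment> \<open>The inner sum from \<open>euler_term\<close> stops before \<open>m\<close>;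
      the extra diagonal term has total exponent \<open>2 * K + 1\<close> and yields
      \<open>zeta_bar (2 * K + 1)\<close>.\<close>
    have h: "harmonic_two_sided ?p m = 2 * (\<Sum>j=1..<m. 1 / real j ^ ?p) + 1 / real m ^ ?p"
      unfolding harmonic_two_sided_def two_sided_partial_def m
      by (simp add: atLeastLessThanSuc_atLeastAtMost)
    have w: "real m ^ ?w = real m ^ ?p * real m ^ ?q" by (simp add: K_def flip: power_add)
    show ?thesis
      unfolding h w by (simp add: distrib_left add_divide_distrib)
  qed
    then have "(\<Sum>m=1..N. 2 * ((-1) ^ m / real m ^ ?q * (- 2 * (\<Sum>j=1..<m. 1 / real j ^ ?p)))) =
      (\<Sum>m=1..N. - 2 * ((-1) ^ m * harmonic_two_sided ?p m / real m ^ ?q - (-1) ^ m / real m ^ ?w))"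
      by (rule sum.cong[OF refl])
    then show ?thesis by (simp only: sum_distrib_left[symmetric] sum_subtractf)
  qed
  moreover have "(\<lambda>N. - 2 * ((\<Sum>m=1..N. (-1) ^ m * harmonic_two_sided ?p m / real m ^ ?q) - (\<Sum>m=1..N. (-1) ^ m / real m ^ ?w)))
      \<longlonglongrightarrow> - 2 * (alt_euler_sum ?p ?q - zeta_bar ?w)"
    by (intro tendsto_intros alt_euler_sum_partial_sums zeta_bar_partial_sums) auto
  ultimately have S1: "S = - 2 * (alt_euler_sum ?p ?q - zeta_bar ?w)"
    using LIMSEQ_unique by (metis (no_types, lifting) ext)

  define \<alpha> \<beta> E where "\<alpha> r = real ((2 * r) choose (2 * a)) - (if 2 * r = 2 * a then 1 else 0)"
    and "\<beta> r = real ((2 * r) choose (2 * b + 1))" and "E r = 2 * zeta_bar (2 * (K - r))" for r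
  define A where "A = real ((2 * K) choose ?q)"
  define B where "B = real ((2 * K) choose ?p)"
  define V where "V k = (\<Sum>r<K. recip_power (2 * r + 1) k * E r * (\<alpha> r + \<beta> r * alt_sign k))
       - A * recip_power ?w k - alt_sign k * (B - 1) * recip_power ?w k" for k
  have "((\<lambda>(k, n). euler_term ?p ?q n k) has_sum S) (Sigma (- {0}) (\<lambda>k. - {0, k}))"
  proof -
    have "((\<lambda>(k, n). euler_term ?p ?q n k) has_sum S) (Sigma (- {0}) (\<lambda>k. - {0, k})) \<longleftrightarrow>
      ((\<lambda>(n, k). euler_term ?p ?q n k) has_sum S) off_diagonal"
      by (rule has_sum_reindex_bij_witness[where i = "\<lambda>(x, y). (y, x)" and j = "\<lambda>(x, y). (y, x)"])
         (auto simp: off_diagonal_def)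
    then show ?thesis using S by simp
  qed
  then have "((\<lambda>k. sgn (real_of_int k) * V k) has_sum S) (- {0})"
  proof (rule has_sum_SigmaD)
    fix k :: int assume "k \<in> - {0}"
    then show "((\<lambda>n. case (k, n) of (k, n) \<Rightarrow> euler_term ?p ?q n k) has_sum sgn (real_of_int k) * V k) (- {0, k})"
      using euler_term_has_sum_n[OF PQ, of k] by (simp add: V_def \<alpha>_def \<beta>_def E_def A_def B_def)
  qed
  from has_sum_symmetric_partial_sums[OF this]
  have "(\<lambda>N. \<Sum>m=1..N. sgn (real_of_int (int m)) * V (int m) + sgn (real_of_int (- int m)) * V (- int m)) \<longlonglongrightarrow> S"
    unfolding sum_symmetric_int_interval .
  moreover have "(\<Sum>m=1..N. sgn (real_of_int (int m)) * V (int m) + sgn (real_of_int (- int m)) * V (- int m)) =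
     2 * ((\<Sum>r<K. E r * (\<alpha> r * (\<Sum>m=1..N. 1 / real m ^ (2 * r + 1)) + \<beta> r * (\<Sum>m=1..N. (-1) ^ m / real m ^ (2 * r + 1))))
       - A * (\<Sum>m=1..N. 1 / real m ^ ?w) - (B - 1) * (\<Sum>m=1..N. (-1) ^ m / real m ^ ?w))" for N
  proof -
    \<comment> \<open>Only odd powers of \<open>1 / k\<close> occur, so together with the sign
      factor \<open>k\<close> and \<open>- k\<close> contribute equally.\<close>
    have V_minus: "V (- k) = - V k" for k
      unfolding V_def by (simp add: recip_power_minus sum_negf)
    have "(\<Sum>m=1..N. sgn (real_of_int (int m)) * V (int m) + sgn (real_of_int (- int m)) * V (- int m)) =
        (\<Sum>m=1..N. 2 * V (int m))"
      by (intro sum.cong refl) (simp add: V_minus sgn_minus)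
    moreover have "(\<Sum>m=1..N. V (int m)) =
       (\<Sum>m=1..N. \<Sum>r<K. E r * (\<alpha> r * (1 / real m ^ (2 * r + 1)) + \<beta> r * ((-1) ^ m / real m ^ (2 * r + 1))))
       - A * (\<Sum>m=1..N. 1 / real m ^ ?w) - (B - 1) * (\<Sum>m=1..N. (-1) ^ m / real m ^ ?w)"
      unfolding sum_distrib_left sum_subtractf[symmetric] V_def
      by (intro sum.cong refl arg_cong2[where f = minus])
         (simp_all add: alt_sign_int recip_power_int add_divide_distrib algebra_simps)
    moreover have "(\<Sum>m=1..N. \<Sum>r<K. E r * (\<alpha> r * (1 / real m ^ (2 * r + 1)) + \<beta> r * ((-1) ^ m / real m ^ (2 * r + 1)))) =
      (\<Sum>r<K. E r * (\<alpha> r * (\<Sum>m=1..N. 1 / real m ^ (2 * r + 1)) + \<beta> r * (\<Sum>m=1..N. (-1) ^ m / real m ^ (2 * r + 1))))"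
      by (subst sum.swap) (simp only: sum_distrib_left sum.distrib distrib_left)
    ultimately show ?thesis by (simp only: sum_distrib_left[symmetric])
  qed
  moreover have "(\<lambda>N. 2 * ((\<Sum>r<K. E r * (\<alpha> r * (\<Sum>m=1..N. 1 / real m ^ (2 * r + 1)) + \<beta> r * (\<Sum>m=1..N. (-1) ^ m / real m ^ (2 * r + 1))))
       - A * (\<Sum>m=1..N. 1 / real m ^ ?w) - (B - 1) * (\<Sum>m=1..N. (-1) ^ m / real m ^ ?w))) \<longlonglongrightarrow>
     2 * ((\<Sum>r<K. E r * (\<alpha> r * mzv [2 * r + 1] + \<beta> r * zeta_bar (2 * r + 1)))
       - A * mzv [?w] - (B - 1) * zeta_bar ?w)"
  proof (intro tendsto_mult[OF tendsto_const] tendsto_diff tendsto_sum mzv_single_partial_sums zeta_bar_partial_sums)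
    fix r assume "r \<in> {..<K}"
    show "(\<lambda>N. \<alpha> r * (\<Sum>m=1..N. 1 / real m ^ (2 * r + 1)) + \<beta> r * (\<Sum>m=1..N. (-1) ^ m / real m ^ (2 * r + 1))) \<longlonglongrightarrow>
      \<alpha> r * mzv [2 * r + 1] + \<beta> r * zeta_bar (2 * r + 1)"
    \<comment> \<open>At \<open>r = 0\<close> the non-alternating series diverges, but both
      coefficients are 0.\<close>
    proof (cases "r = 0")
      case True
      then have "\<alpha> r = 0" "\<beta> r = 0" by (auto simp: \<alpha>_def \<beta>_def)
      then show ?thesis by simp
    next
      case False
      then show ?thesis by (intro tendsto_intros mzv_single_partial_sums zeta_bar_partial_sums) auto
    qed
  qed (auto simp: K_def)
  ultimately have S2: "S = 2 * ((\<Sum>r<K. E r * (\<alpha> r * mzv [2 * r + 1] + \<beta> r * zeta_bar (2 * r + 1)))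
       - A * mzv [?w] - (B - 1) * zeta_bar ?w)"
    using LIMSEQ_unique by (metis (no_types, lifting) ext)
  \<comment> \<open>The diagonal contribution in \<open>S1\<close> turns \<open>B - 1\<close> into
    \<open>B\<close>.\<close>
  have "alt_euler_sum ?p ?q = A * mzv [?w] + B * zeta_bar ?w
     - (\<Sum>r<K. E r * (\<alpha> r * mzv [2 * r + 1] + \<beta> r * zeta_bar (2 * r + 1)))"
    using S1 S2 by (simp add: algebra_simps)
  then show ?thesis by (simp add: A_def B_def E_def \<alpha>_def \<beta>_def)
qed

section \<open>From star values to non-star values\<close>

lemma H2_star_tendsto: "(\<lambda>N. truncated_mzv (\<le>) (replicate n 2) N) \<longlonglongrightarrow> H2_star n"
  and H2_star_eq: "n > 0 \<Longrightarrow> H2_star n = - 2 * zeta_bar (2 * n)"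
proof -
  have lim: "(\<lambda>N. truncated_mzv (\<le>) (replicate n 2) N) \<longlonglongrightarrow> - 2 * zeta_bar (2 * n)" if "n > 0"
  proof -
    have "summable (\<lambda>l. \<bar>1\<bar> / real (Suc l) ^ (2 * n))"
      by (subst summable_Suc_iff)
         (use inverse_power_summable[of "2 * n", where 'a = real] that in \<open>simp add: inverse_eq_divide\<close>)
    from weighted_alt_sum_tendsto[OF this]
    have "weighted_alt_sum (\<lambda>_. 1) (2 * n) \<longlonglongrightarrow> zeta_bar (2 * n)" by (simp add: zeta_bar_def)
    then show ?thesis unfolding truncated_mzv_le_replicate_2_eq[OF that] by (intro tendsto_intros)
  qed
  then show eq: "n > 0 \<Longrightarrow> H2_star n = - 2 * zeta_bar (2 * n)"
    using mzv_star_eqI[OF lim] by (simp add: H2_star_def)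
  show "(\<lambda>N. truncated_mzv (\<le>) (replicate n 2) N) \<longlonglongrightarrow> H2_star n"
  proof (cases "n = 0")
    case False
    then show ?thesis using lim eq by simp
  qed (simp add: H2_star_def truncated_mzv_Nil)
qed

lemma H3_star_tendsto: "(\<lambda>N. truncated_mzv (\<le>) (replicate a 2 @ [3] @ replicate b 2) N) \<longlonglongrightarrow> H3_star a b"
  and H3_star_eq_alt_euler_sum: "H3_star a b = - 2 * alt_euler_sum (2 * a + 1) (2 * b + 2)"
proof -
  have "weighted_alt_sum (harmonic_two_sided (2 * a + 1)) (2 * b + 2) \<longlonglongrightarrow> alt_euler_sum (2 * a + 1) (2 * b + 2)"
    unfolding alt_euler_sum_def by (intro weighted_alt_sum_tendsto harmonic_two_sided_summable) auto
  then have lim: "(\<lambda>N. truncated_mzv (\<le>) (replicate a 2 @ [3] @ replicate b 2) N) \<longlonglongrightarrow> - 2 * alt_euler_sum (2 * a + 1) (2 * b + 2)"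
    unfolding truncated_mzv_le_2_3_2_eq by (intro tendsto_intros)
  then show eq: "H3_star a b = - 2 * alt_euler_sum (2 * a + 1) (2 * b + 2)"
    unfolding H3_star_def by (rule mzv_star_eqI)
  show "(\<lambda>N. truncated_mzv (\<le>) (replicate a 2 @ [3] @ replicate b 2) N) \<longlonglongrightarrow> H3_star a b"
    using lim unfolding eq .
qed

text \<open>For \<open>r < K\<close> the factor \<open>2 * zeta_bar (2 * (K - r))\<close> is
  \<open>- H2_star (K - r)\<close>. The two isolated terms form the summand \<open>r = K\<close> by
  symmetry of binomial coefficients, and the summand \<open>r = 0\<close> vanishes.\<close>

lemma H3_star_eq:
  fixes a b :: nat
  defines "K \<equiv> a + b + 1"
  shows "H3_star a b = - 2 * (\<Sum>r=1..K.
           ((real ((2 * r) choose (2 * a)) - kronecker_delta r a) * mzv [2 * r + 1]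
            + real ((2 * r) choose (2 * b + 1)) * zeta_bar (2 * r + 1)) * H2_star (K - r))"
proof -
  let ?T = "\<lambda>r. (real ((2 * r) choose (2 * a)) - kronecker_delta r a) * mzv [2 * r + 1]
            + real ((2 * r) choose (2 * b + 1)) * zeta_bar (2 * r + 1)"
  have "K > 0" by (simp add: K_def)
  have "?T 0 = 0" by (simp add: kronecker_delta_def)
  then have "(\<Sum>r=1..K. ?T r * H2_star (K - r)) = (\<Sum>r\<le>K. ?T r * H2_star (K - r))"
    by (simp add: atMost_atLeast0 sum.atLeast_Suc_atMost)
  also have "\<dots> = ?T K + (\<Sum>r<K. ?T r * H2_star (K - r))"
    by (simp add: lessThan_Suc_atMost[symmetric] H2_star_def)
  also have "(\<Sum>r<K. ?T r * H2_star (K - r)) = - (\<Sum>r<K. 2 * zeta_bar (2 * (K - r)) *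
       ((real ((2 * r) choose (2 * a)) - (if r = a then 1 else 0)) * mzv [2 * r + 1]
        + real ((2 * r) choose (2 * b + 1)) * zeta_bar (2 * r + 1)))"
    unfolding sum_negf[symmetric]
    by (intro sum.cong refl) (simp add: H2_star_eq kronecker_delta_def)
  also have "?T K = real ((2 * K) choose (2 * b + 2)) * mzv [2 * K + 1] + real ((2 * K) choose (2 * a + 1)) * zeta_bar (2 * K + 1)"
    using binomial_symmetric[of "2 * a" "2 * K"] binomial_symmetric[of "2 * a + 1" "2 * K"]
    by (simp add: K_def kronecker_delta_def)
  finally show ?thesis
    unfolding H3_star_eq_alt_euler_sum alt_euler_sum_eq K_def by simp
qed

section \<open>Generating functions of the truncated values\<close>

unbundle no vec_syntax
notation fps_nth (infixl "$" 75)

lemma fps_mult_linear_nth: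
  "(F * (1 - fps_const c * fps_X)) $ i = F $ i - c * (if i = 0 then 0 else F $ (i - 1))"
  for F :: "'a :: comm_ring_1 fps"
proof -
  have "F * (1 - fps_const c * fps_X) = F - fps_const c * (fps_X * F)" by (simp add: algebra_simps)
  then show ?thesis by simp
qed

definition recip_square :: "nat \<Rightarrow> real" where
  "recip_square N = 1 / real (Suc N) ^ 2"

text \<open>With this sign it is the product of \<open>1 - x / j^2\<close> over
  \<open>j \<le> N\<close>, and \<open>complete_fps\<close> is its inverse.\<close>

definition elem_fps :: "nat \<Rightarrow> real fps" where
  "elem_fps N = Abs_fps (\<lambda>i. (-1) ^ i * truncated_mzv (<) (replicate i 2) N)"

definition complete_fps :: "nat \<Rightarrow> real fps" where
  "complete_fps N = Abs_fps (\<lambda>i. truncated_mzv (\<le>) (replicate i 2) N)"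

lemma replicate_Suc_snoc: "replicate (Suc n) x = replicate n x @ [x]"
  by (simp add: replicate_append_same)

lemma replicate_Suc_snoc3: "xs @ [y] @ replicate (Suc n) x = (xs @ [y] @ replicate n x) @ [x]"
  by (simp add: replicate_append_same)

lemma elem_fps_0: "elem_fps 0 = 1"
proof (rule fps_ext)
  fix i show "elem_fps 0 $ i = 1 $ i"
    by (cases i) (simp_all add: elem_fps_def truncated_mzv_Nil replicate_Suc_snoc truncated_mzv_snoc_0 del: replicate_Suc)
qed

lemma complete_fps_0: "complete_fps 0 = 1"
proof (rule fps_ext)
  fix i show "complete_fps 0 $ i = 1 $ i"
    by (cases i) (simp_all add: complete_fps_def truncated_mzv_Nil replicate_Suc_snoc truncated_mzv_snoc_0 del: replicate_Suc)
qed

lemma elem_fps_Suc: "elem_fps (Suc N) = elem_fps N * (1 - fps_const (recip_square N) * fps_X)"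
proof (rule fps_ext)
  fix i show "elem_fps (Suc N) $ i = (elem_fps N * (1 - fps_const (recip_square N) * fps_X)) $ i"
    unfolding fps_mult_linear_nth
    by (cases i) (simp_all add: elem_fps_def truncated_mzv_Nil replicate_Suc_snoc truncated_mzv_less_snoc_Suc recip_square_def
        algebra_simps del: replicate_Suc)
qed

lemma complete_fps_Suc: "complete_fps (Suc N) * (1 - fps_const (recip_square N) * fps_X) = complete_fps N"
proof (rule fps_ext)
  fix i show "(complete_fps (Suc N) * (1 - fps_const (recip_square N) * fps_X)) $ i = complete_fps N $ i"
    unfolding fps_mult_linear_nth
    by (cases i) (simp_all add: complete_fps_def truncated_mzv_Nil replicate_Suc_snoc truncated_mzv_le_snoc_Suc recip_square_def
        algebra_simps del: replicate_Suc)
qed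

lemma elem_complete_fps: "elem_fps N * complete_fps N = 1"
proof (induction N)
  case (Suc N)
  have "elem_fps (Suc N) * complete_fps (Suc N) =
      elem_fps N * (complete_fps (Suc N) * (1 - fps_const (recip_square N) * fps_X))"
    unfolding elem_fps_Suc by (simp only: mult_ac)
  then show ?case using Suc unfolding complete_fps_Suc by simp
qed (simp add: elem_fps_0 complete_fps_0)

definition star_fps :: "nat \<Rightarrow> nat \<Rightarrow> real fps" where
  "star_fps b N = Abs_fps (\<lambda>a. truncated_mzv (\<le>) (replicate b 2 @ [3] @ replicate a 2) N)"

text \<open>A two-variable series is handled as a family of one-variable series. In
  \<open>star_fps\<close> the variable marks the twos after the 3; here it is multiplied by
  \<open>elem_fps\<close> in that variable, then coefficient index and parameter trade places so
  that the second factor can be applied.\<close>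

definition mixed_fps :: "nat \<Rightarrow> nat \<Rightarrow> real fps" where
  "mixed_fps a N = Abs_fps (\<lambda>b. (elem_fps N * star_fps b N) $ a)"

definition nonstar_fps :: "nat \<Rightarrow> nat \<Rightarrow> real fps" where
  "nonstar_fps a N = Abs_fps (\<lambda>b. (-1) ^ (a + b) * truncated_mzv (<) (replicate a 2 @ [3] @ replicate b 2) N)"

text \<open>The linear factor cancels the effect of a final index 2. Only the constant coefficient,
  where the 3 comes last, receives a new term.\<close>

lemma star_fps_Suc:
  "star_fps b (Suc N) * (1 - fps_const (recip_square N) * fps_X) =
    star_fps b N + fps_const (complete_fps (Suc N) $ b / real (Suc N) ^ 3)"
proof (rule fps_ext)
  fix a show "(star_fps b (Suc N) * (1 - fps_const (recip_square N) * fps_X)) $ a =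
      (star_fps b N + fps_const (complete_fps (Suc N) $ b / real (Suc N) ^ 3)) $ a"
  proof (cases a)
    case 0
    then show ?thesis unfolding fps_mult_linear_nth
      by (simp add: star_fps_def complete_fps_def truncated_mzv_le_snoc_Suc)
  next
    case (Suc a')
    show ?thesis unfolding fps_mult_linear_nth Suc
      by (simp add: star_fps_def replicate_Suc_snoc3 truncated_mzv_le_snoc_Suc[of "_ @ _"] recip_square_def
          del: replicate_Suc append_assoc append_Cons append_Nil)
  qed
qed

lemma mixed_fps_Suc:
  "mixed_fps a (Suc N) = mixed_fps a N + fps_const (elem_fps N $ a / real (Suc N) ^ 3) * complete_fps (Suc N)"
proof (rule fps_ext)
  fix b
  have "elem_fps (Suc N) * star_fps b (Suc N) =
      elem_fps N * (star_fps b (Suc N) * (1 - fps_const (recip_square N) * fps_X))"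
    unfolding elem_fps_Suc by (simp only: mult_ac)
  also have "\<dots> = elem_fps N * star_fps b N + fps_const (complete_fps (Suc N) $ b / real (Suc N) ^ 3) * elem_fps N"
    unfolding star_fps_Suc by (simp only: distrib_left mult.commute)
  finally show "mixed_fps a (Suc N) $ b =
      (mixed_fps a N + fps_const (elem_fps N $ a / real (Suc N) ^ 3) * complete_fps (Suc N)) $ b"
    by (simp add: mixed_fps_def)
qed

lemma nonstar_fps_Suc:
  "nonstar_fps a (Suc N) = nonstar_fps a N * (1 - fps_const (recip_square N) * fps_X)
     + fps_const (elem_fps N $ a / real (Suc N) ^ 3)"
proof (rule fps_ext)
  fix b show "nonstar_fps a (Suc N) $ b = (nonstar_fps a N * (1 - fps_const (recip_square N) * fps_X)
     + fps_const (elem_fps N $ a / real (Suc N) ^ 3)) $ b"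
    unfolding fps_add_nth fps_mult_linear_nth
  proof (cases b)
    case 0
    then show "nonstar_fps a (Suc N) $ b = nonstar_fps a N $ b - recip_square N * (if b = 0 then 0 else nonstar_fps a N $ (b - 1))
      + fps_const (elem_fps N $ a / real (Suc N) ^ 3) $ b"
      by (simp add: nonstar_fps_def elem_fps_def truncated_mzv_less_snoc_Suc algebra_simps)
  next
    case (Suc b')
    show "nonstar_fps a (Suc N) $ b = nonstar_fps a N $ b - recip_square N * (if b = 0 then 0 else nonstar_fps a N $ (b - 1))
      + fps_const (elem_fps N $ a / real (Suc N) ^ 3) $ b"
      unfolding Suc
      by (simp add: nonstar_fps_def replicate_Suc_snoc3 truncated_mzv_less_snoc_Suc[of "_ @ _"] recip_square_def distrib_left
          del: replicate_Suc append_assoc append_Cons append_Nil)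
  qed
qed

text \<open>In the induction step the new term of \<open>mixed_fps\<close> carries
  \<open>complete_fps (Suc N)\<close>, which \<open>elem_fps (Suc N)\<close> cancels; what remains
  is the recursion \<open>nonstar_fps_Suc\<close>.\<close>

lemma nonstar_fps_eq: "nonstar_fps a N = elem_fps N * mixed_fps a N"
proof (induction N)
  case 0
  have "nonstar_fps a 0 $ b = 0" for b
    by (cases b) (simp_all add: nonstar_fps_def replicate_Suc_snoc3 truncated_mzv_snoc_0 truncated_mzv_snoc_0[of _ "_ @ _"]
        del: replicate_Suc append_assoc append_Cons append_Nil)
  moreover have "star_fps b 0 $ a = 0" for b a
    by (cases a) (simp_all add: star_fps_def replicate_Suc_snoc3 truncated_mzv_snoc_0 truncated_mzv_snoc_0[of _ "_ @ _"]
        del: replicate_Suc append_assoc append_Cons append_Nil)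
  then have "star_fps b 0 = 0" for b by (intro fps_ext) simp
  then have "mixed_fps a 0 = 0" by (intro fps_ext) (simp add: mixed_fps_def)
  ultimately show ?case by (intro fps_ext) simp
next
  case (Suc N)
  let ?c = "fps_const (elem_fps N $ a / real (Suc N) ^ 3)"
  have "elem_fps (Suc N) * mixed_fps a (Suc N) =
      elem_fps N * mixed_fps a N * (1 - fps_const (recip_square N) * fps_X) + ?c * (elem_fps (Suc N) * complete_fps (Suc N))"
    unfolding mixed_fps_Suc distrib_left by (simp only: elem_fps_Suc mult_ac)
  then show ?case unfolding nonstar_fps_Suc Suc elem_complete_fps by simp
qed

lemma truncated_mzv_less_2_3_2_eq:
  "truncated_mzv (<) (replicate a 2 @ [3] @ replicate b 2) N =
     (-1) ^ (a + b) * (\<Sum>j=0..b. elem_fps N $ j * (\<Sum>i=0..a. elem_fps N $ i *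
        truncated_mzv (\<le>) (replicate (b - j) 2 @ [3] @ replicate (a - i) 2) N))"
proof -
  have "(\<Sum>j=0..b. elem_fps N $ j * (\<Sum>i=0..a. elem_fps N $ i *
        truncated_mzv (\<le>) (replicate (b - j) 2 @ [3] @ replicate (a - i) 2) N)) = (elem_fps N * mixed_fps a N) $ b"
    by (simp add: fps_mult_nth mixed_fps_def star_fps_def)
  also have "\<dots> = (-1) ^ (a + b) * truncated_mzv (<) (replicate a 2 @ [3] @ replicate b 2) N"
    unfolding nonstar_fps_eq[symmetric] by (simp add: nonstar_fps_def)
  finally show ?thesis by simp
qed

text \<open>Convergence needs no separate estimate: \<open>elem_complete_fps\<close> expresses each
  coefficient through lower ones and convergent star values.\<close>

lemma elem_fps_nth_tendsto: "(\<lambda>N. elem_fps N $ n) \<longlonglongrightarrow> (-1) ^ n * H2 n"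
proof -
  have "convergent (\<lambda>N. elem_fps N $ n)"
  proof (induction n rule: less_induct)
    case (less n)
    have rec: "elem_fps N $ n = (if n = 0 then 1 else 0) - (\<Sum>i<n. elem_fps N $ i * complete_fps N $ (n - i))" for N
    proof -
      have "(\<Sum>i=0..n. elem_fps N $ i * complete_fps N $ (n - i)) = (if n = 0 then 1 else 0)"
        using arg_cong[OF elem_complete_fps, of "\<lambda>F. F $ n"] by (simp add: fps_mult_nth)
      moreover have "{0..n} = insert n {..<n}" by auto
      moreover have "complete_fps N $ 0 = 1" by (simp add: complete_fps_def truncated_mzv_Nil)
      ultimately show ?thesis by simp
    qed
    have "convergent (\<lambda>N. complete_fps N $ i)" for i
      using H2_star_tendsto[of i] by (auto simp: complete_fps_def convergent_def)
    then show ?case unfolding rec using less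
      by (intro convergent_diff convergent_const convergent_sum convergent_mult) auto
  qed
  then obtain L where L: "(\<lambda>N. elem_fps N $ n) \<longlonglongrightarrow> L" by (auto simp: convergent_def)
  from tendsto_mult[OF tendsto_const[of "(-1) ^ n"] L]
  have lim: "(\<lambda>N. truncated_mzv (<) (replicate n 2) N) \<longlonglongrightarrow> (-1) ^ n * L"
    by (simp add: elem_fps_def flip: mult.assoc power_mult_distrib)
  have "H2 n = (-1) ^ n * L"
  proof (cases "n = 0")
    case True
    with lim have "(\<lambda>N. 1) \<longlonglongrightarrow> L" by (simp add: truncated_mzv_Nil)
    then have "L = 1" using LIMSEQ_unique tendsto_const by blast
    then show ?thesis using True by (simp add: H2_def)
  next
    case False
    then show ?thesis using mzv_eqI[OF lim] by (simp add: H2_def)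
  qed
  then show ?thesis using L by (simp flip: mult.assoc power_mult_distrib)
qed

definition signed_H2_fps :: "real fps" where
  "signed_H2_fps = Abs_fps (\<lambda>n. (-1) ^ n * H2 n)"

lemma signed_H2_fps_inverse: "signed_H2_fps * Abs_fps H2_star = 1"
proof (rule fps_ext)
  fix n
  have "(\<lambda>N. (elem_fps N * complete_fps N) $ n) \<longlonglongrightarrow> (signed_H2_fps * Abs_fps H2_star) $ n"
    unfolding fps_mult_nth signed_H2_fps_def fps_nth_Abs_fps
    by (intro tendsto_intros elem_fps_nth_tendsto) (simp add: complete_fps_def H2_star_tendsto)
  then show "(signed_H2_fps * Abs_fps H2_star) $ n = 1 $ n"
    unfolding elem_complete_fps using LIMSEQ_unique tendsto_const by blast
qed

text \<open>Convolution with \<open>H2_star\<close> is undone by convolution with the signed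
  \<open>H2\<close>, the inverse power series.\<close>

lemma signed_H2_convolution:
  assumes "\<And>m. m \<le> n \<Longrightarrow> g m = (\<Sum>t=0..m. f t * H2_star (m - t))"
  shows "(\<Sum>i=0..n. (-1) ^ i * H2 i * g (n - i)) = f n"
proof -
  have "(\<Sum>i=0..n. (-1) ^ i * H2 i * g (n - i)) = (signed_H2_fps * (Abs_fps f * Abs_fps H2_star)) $ n"
    unfolding fps_mult_nth[of signed_H2_fps] by (simp add: signed_H2_fps_def assms fps_mult_nth)
  also have "\<dots> = (Abs_fps f * (signed_H2_fps * Abs_fps H2_star)) $ n" by (simp only: mult_ac)
  finally show ?thesis by (simp add: signed_H2_fps_inverse)
qed

lemma H3_eq_H3_star_convolution:
  "H3 a b = (-1) ^ (a + b) * (\<Sum>j=0..b. (-1) ^ j * H2 j * (\<Sum>i=0..a. (-1) ^ i * H2 i * H3_star (b - j) (a - i)))"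
  unfolding H3_def by (rule mzv_eqI, subst truncated_mzv_less_2_3_2_eq) (intro tendsto_intros elem_fps_nth_tendsto H3_star_tendsto)

lemma sum_vanishing_prefix:
  fixes f :: "nat \<Rightarrow> real"
  assumes "\<And>r. r \<le> c \<Longrightarrow> f r = 0"
  shows "(\<Sum>r=1..c + d + 1. f r) = (\<Sum>t=0..d. f (c + 1 + t))"
proof -
  have "(\<Sum>r=1..c + d + 1. f r) = (\<Sum>r=c + 1..c + d + 1. f r)"
    using assms by (intro sum.mono_neutral_right) auto
  also have "\<dots> = (\<Sum>t=0..d. f (c + 1 + t))"
    by (rule sum.reindex_bij_witness[where i = "\<lambda>t. c + 1 + t" and j = "\<lambda>r. r - (c + 1)"]) auto
  finally show ?thesis .
qed

text \<open>Each of the two parts of \<open>H3_star\<close> is a convolution with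
  \<open>H2_star\<close> in only one of the two indices. The signed convolution in that index
  collapses it to one term; the other becomes the sum over \<open>r = K - j\<close>, with binomials
  reflected by symmetry.\<close>

lemma H3_eq:
  fixes a b :: nat
  defines "K \<equiv> a + b + 1"
  shows "H3 a b = 2 * (\<Sum>r=1..K. (-1) ^ r *
           (real ((2 * r) choose (2 * a + 2)) * mzv [2 * r + 1]
            + real ((2 * r) choose (2 * b + 1)) * zeta_bar (2 * r + 1)) * H2 (K - r))"
proof -
  define \<alpha> where "\<alpha> r b = (real ((2 * r) choose (2 * b)) - kronecker_delta r b) * mzv [2 * r + 1]" for r b
  define \<beta> where "\<beta> r a = real ((2 * r) choose (2 * a + 1)) * zeta_bar (2 * r + 1)" for r a
  \<comment> \<open>The sum starts at \<open>b + 1\<close>: for \<open>r < b\<close> the binomial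
    vanishes and at \<open>r = b\<close> the Kronecker delta cancels it. In \<open>T2\<close> the
    binomial alone vanishes for \<open>r \<le> a\<close>.\<close>
  define T1 where "T1 b a = (\<Sum>t=0..a. \<alpha> (b + 1 + t) b * H2_star (a - t))" for b a
  define T2 where "T2 b a = (\<Sum>t=0..b. \<beta> (a + 1 + t) a * H2_star (b - t))" for b a
  have star: "H3_star b a = - 2 * (T1 b a + T2 b a)" for a b
  proof -
    have "H3_star b a = - 2 * ((\<Sum>r=1..b + a + 1. \<alpha> r b * H2_star (b + a + 1 - r)) + (\<Sum>r=1..a + b + 1. \<beta> r a * H2_star (b + a + 1 - r)))"
      unfolding H3_star_eq \<alpha>_def \<beta>_def by (simp add: sum.distrib distrib_right add.commute)
    moreover have "(\<Sum>r=1..b + a + 1. \<alpha> r b * H2_star (b + a + 1 - r)) = T1 b a"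
      unfolding T1_def by (subst sum_vanishing_prefix) (auto simp: \<alpha>_def kronecker_delta_def binomial_eq_0 le_less)
    moreover have "(\<Sum>r=1..a + b + 1. \<beta> r a * H2_star (b + a + 1 - r)) = T2 b a"
      unfolding T2_def by (subst sum_vanishing_prefix) (auto simp: \<beta>_def binomial_eq_0)
    ultimately show ?thesis by simp
  qed
  let ?e = "\<lambda>i. (-1) ^ i * H2 i"
  have conv1: "(\<Sum>i=0..a. ?e i * T1 b (a - i)) = \<alpha> (b + 1 + a) b" for a b
    by (rule signed_H2_convolution) (simp add: T1_def)
  have conv2: "(\<Sum>j=0..b. ?e j * T2 (b - j) a) = \<beta> (a + 1 + b) a" for a b
    by (rule signed_H2_convolution) (simp add: T2_def)
  have "(\<Sum>j=0..b. ?e j * (\<Sum>i=0..a. ?e i * H3_star (b - j) (a - i))) =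
      - 2 * ((\<Sum>j=0..b. ?e j * (\<Sum>i=0..a. ?e i * T1 (b - j) (a - i)))
           + (\<Sum>j=0..b. \<Sum>i=0..a. ?e j * (?e i * T2 (b - j) (a - i))))"
    unfolding star by (simp only: sum.distrib sum_distrib_left distrib_left mult_ac)
  also have "(\<Sum>j=0..b. \<Sum>i=0..a. ?e j * (?e i * T2 (b - j) (a - i))) =
      (\<Sum>i=0..a. ?e i * (\<Sum>j=0..b. ?e j * T2 (b - j) (a - i)))"
    by (subst sum.swap) (simp only: sum_distrib_left mult_ac)
  finally have sum_eq: "(\<Sum>j=0..b. ?e j * (\<Sum>i=0..a. ?e i * H3_star (b - j) (a - i))) =
      - 2 * ((\<Sum>j=0..b. ?e j * \<alpha> (b - j + 1 + a) (b - j)) + (\<Sum>i=0..a. ?e i * \<beta> (a - i + 1 + b) (a - i)))"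
    unfolding conv1 conv2 .
  let ?A = "\<lambda>r. (-1) ^ r * (real ((2 * r) choose (2 * a + 2)) * mzv [2 * r + 1]) * H2 (K - r)"
  let ?B = "\<lambda>r. (-1) ^ r * (real ((2 * r) choose (2 * b + 1)) * zeta_bar (2 * r + 1)) * H2 (K - r)"
  \<comment> \<open>The minus sign arises because \<open>K\<close> exceeds \<open>a + b\<close> by
    one.\<close>
  have sign: "(-1) ^ (a + b) * (-1) ^ j = - ((-1) ^ (K - j) :: real)" if "j \<le> K" for j
    using that by (auto simp: K_def minus_one_power_iff)
  have A: "(-1) ^ (a + b) * (\<Sum>j=0..b. ?e j * \<alpha> (b - j + 1 + a) (b - j)) = - (\<Sum>r=1..K. ?A r)"
  proof -
    have "(\<Sum>r=1..K. ?A r) = (\<Sum>r=a + 1..K. ?A r)"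
      by (rule sum.mono_neutral_right) (auto simp: K_def)
    also have "\<dots> = (\<Sum>j=0..b. - ((-1) ^ (a + b) * (?e j * \<alpha> (b - j + 1 + a) (b - j))))"
    proof (rule sum.reindex_bij_witness[where i = "\<lambda>j. K - j" and j = "\<lambda>r. K - r"])
      fix r assume r: "r \<in> {a + 1..K}"
      then have "b - (K - r) + 1 + a = r" "2 * (b - (K - r)) = 2 * r - (2 * a + 2)" "2 * a + 2 \<le> 2 * r" "b - (K - r) \<noteq> r"
        by (auto simp: K_def)
      then have "\<alpha> (b - (K - r) + 1 + a) (b - (K - r)) = real ((2 * r) choose (2 * a + 2)) * mzv [2 * r + 1]"
        using binomial_symmetric[of "2 * a + 2" "2 * r"] by (simp add: \<alpha>_def kronecker_delta_def)
      moreover have "(-1) ^ (a + b) * (-1) ^ (K - r) = - ((-1) ^ r :: real)"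
        using sign[of "K - r"] r by simp
      ultimately show "- ((-1) ^ (a + b) * (?e (K - r) * \<alpha> (b - (K - r) + 1 + a) (b - (K - r)))) = ?A r"
        by (simp flip: mult.assoc)
    qed (auto simp: K_def)
    finally show ?thesis by (simp add: sum_negf sum_distrib_left)
  qed
  have B: "(-1) ^ (a + b) * (\<Sum>i=0..a. ?e i * \<beta> (a - i + 1 + b) (a - i)) = - (\<Sum>r=1..K. ?B r)"
  proof -
    have "(\<Sum>r=1..K. ?B r) = (\<Sum>r=b + 1..K. ?B r)"
      by (rule sum.mono_neutral_right) (auto simp: K_def)
    also have "\<dots> = (\<Sum>i=0..a. - ((-1) ^ (a + b) * (?e i * \<beta> (a - i + 1 + b) (a - i))))"
    proof (rule sum.reindex_bij_witness[where i = "\<lambda>j. K - j" and j = "\<lambda>r. K - r"])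
      fix r assume r: "r \<in> {b + 1..K}"
      then have "a - (K - r) + 1 + b = r" "2 * (a - (K - r)) + 1 = 2 * r - (2 * b + 1)" "2 * b + 1 \<le> 2 * r"
        by (auto simp: K_def)
      then have "\<beta> (a - (K - r) + 1 + b) (a - (K - r)) = real ((2 * r) choose (2 * b + 1)) * zeta_bar (2 * r + 1)"
        using binomial_symmetric[of "2 * b + 1" "2 * r"] by (simp add: \<beta>_def)
      moreover have "(-1) ^ (a + b) * (-1) ^ (K - r) = - ((-1) ^ r :: real)"
        using sign[of "K - r"] r by simp
      ultimately show "- ((-1) ^ (a + b) * (?e (K - r) * \<beta> (a - (K - r) + 1 + b) (a - (K - r)))) = ?B r"
        by (simp flip: mult.assoc)
    qed (auto simp: K_def)
    finally show ?thesis by (simp add: sum_negf sum_distrib_left)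
  qed
  have "H3 a b = - 2 * ((-1) ^ (a + b) * (\<Sum>j=0..b. ?e j * \<alpha> (b - j + 1 + a) (b - j))
      + (-1) ^ (a + b) * (\<Sum>i=0..a. ?e i * \<beta> (a - i + 1 + b) (a - i)))"
    unfolding H3_eq_H3_star_convolution sum_eq by (simp only: algebra_simps)
  also have "\<dots> = 2 * ((\<Sum>r=1..K. ?A r) + (\<Sum>r=1..K. ?B r))" unfolding A B by simp
  finally show ?thesis unfolding sum.distrib[symmetric] by (simp add: algebra_simps)
qed

theorem theorem1p1:
  fixes a b K :: nat
  assumes "K = a + b + 1"
  shows "H3 a b = 2 * (\<Sum>r=1..K. (-1) ^ r *
           (real ((2 * r) choose (2 * a + 2)) * mzv [2 * r + 1]
            + real ((2 * r) choose (2 * b + 1)) * zeta_bar (2 * r + 1)) * H2 (K - r))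
       \<and> H3_star a b = - 2 * (\<Sum>r=1..K.
           ((real ((2 * r) choose (2 * a)) - kronecker_delta r a) * mzv [2 * r + 1]
            + real ((2 * r) choose (2 * b + 1)) * zeta_bar (2 * r + 1)) * H2_star (K - r))"
  unfolding assms by (intro conjI H3_eq H3_star_eq)

end
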